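(* Let $d=3$. For every $\alpha>0$ there exist $\epsilon(\alpha)>0$ and $c(\alpha)>0$ such that for all integers $n\ge 1$, $$\mathbb{P}[0\overset{\mathcal{L}_{\alpha}}{\longleftrightarrow}\partial B(0,n)]\ge c(\alpha)\,n^{-1+\epsilon(\alpha)}.$$
   Context: Let $Q=(Q^x_y)_{x,y}$ be the transition matrix of simple random walk on $\mathbb{Z}^d$. A based loop is an element $\dot\ell=(x_1,\dots,x_n)\in(\mathbb{Z}^d)^n$, $n\ge 2$, with $x_1\ne x_2,\dots,x_{n-1}\neq x_n,x_n\ne x_1$; loops are equivalence classes of based loops under circular permutation. Put $\dot\mu(\dot\ell)=\frac1n Q^{x_1}_{x_2}\cdots Q^{x_{n-1}}_{x_n}Q^{x_n}_{x_1}$ and let $\mu$ be the push-forward of $\dot\mu$ to the space of loops. For $\alpha>0$, $\mathcal{L}_\alpha$ is the Poisson point process of loops with intensity $\alpha\mu$. An edge of $\mathbb{Z}^d$ is open if it is traversed by at least one loop of $\mathcal{L}_\alpha$ (a loop $(x_1,\dots,x_n)$ traverses $\{x_i,x_{i+1}\}$ and $\{x_n,x_1\}$). $0\overset{\mathcal{L}_\alpha}{\longleftrightarrow}A$ means that $0$ is connected to some vertex of $A$ by a path of open edges. $B(x,n)=\{y:\|y-x\|_\infty\le n\}$, and $\partial F=\{x\in F:\ x\text{ has a neighbour outside }F\}$. *)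

theory Defs
  imports "HOL-Probability.Probability"
begin

definition adj :: "int ^ 'd::finite \<Rightarrow> int ^ 'd \<Rightarrow> bool" where
  "adj x y \<longleftrightarrow> (\<Sum>i\<in>UNIV. \<bar>x $ i - y $ i\<bar>) = 1"

definition Q :: "int ^ 'd::finite \<Rightarrow> int ^ 'd \<Rightarrow> real" where
  "Q x y = (if adj x y then 1 / (2 * real CARD('d)) else 0)"

definition sup_norm :: "int ^ 'd::finite \<Rightarrow> int" where
  "sup_norm x = Max (range (\<lambda>i. \<bar>x $ i\<bar>))"

definition lattice_box :: "int ^ 'd::finite \<Rightarrow> nat \<Rightarrow> (int ^ 'd) set" where
  "lattice_box x n = {y. sup_norm (y - x) \<le> int n}"

definition inner_boundary :: "(int ^ 'd::finite) set \<Rightarrow> (int ^ 'd) set" where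
  "inner_boundary F = {x \<in> F. \<exists>y. adj x y \<and> y \<notin> F}"

definition based_loops :: "(int ^ 'd::finite) list set" where
  "based_loops = {l. length l \<ge> 2 \<and> (\<forall>i<length l. l ! i \<noteq> l ! (Suc i mod length l))}"

definition rotation_rel :: "((int ^ 'd::finite) list \<times> (int ^ 'd) list) set" where
  "rotation_rel = {(l, l'). l \<in> based_loops \<and> (\<exists>k. l' = rotate k l)}"

text \<open>A loop is the set of all based loops that represent it.\<close>

definition loops :: "(int ^ 'd::finite) list set set" where
  "loops = based_loops // rotation_rel"

definition based_loop_measure :: "(int ^ 'd::finite) list measure" where
  "based_loop_measure = point_measure based_loops
     (\<lambda>l. ennreal (1 / real (length l) * (\<Prod>i<length l. Q (l ! i) (l ! (Suc i mod length l)))))"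

definition loop_measure :: "(int ^ 'd::finite) list set measure" where
  "loop_measure = distr based_loop_measure (count_space loops) (\<lambda>l. rotation_rel `` {l})"

definition traverses :: "(int ^ 'd::finite) list set \<Rightarrow> int ^ 'd \<Rightarrow> int ^ 'd \<Rightarrow> bool" where
  "traverses L x y \<longleftrightarrow> (\<exists>l\<in>L. \<exists>i<length l. {l ! i, l ! (Suc i mod length l)} = {x, y})"

text \<open>
  A point configuration, possibly with multiplicities, is represented by its counting
  measure: \<open>emeasure \<eta> A\<close> is the number of points of \<open>\<eta>\<close> in \<open>A\<close>. The predicate says
  that \<open>P\<close> is the law, on configurations, of a Poisson point process with intensity
  measure \<open>\<Lambda>\<close>.  The counts are required to be measurable, but the sigma-algebra of \<open>P\<close>
  may be finer than the one they generate.
\<close>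

definition poisson_point_process :: "'a measure \<Rightarrow> 'a measure measure \<Rightarrow> bool" where
  "poisson_point_process \<Lambda> P \<longleftrightarrow>
     prob_space P \<and>
     (\<forall>\<eta>\<in>space P. sets \<eta> = sets \<Lambda> \<and>
        (\<forall>A\<in>sets \<Lambda>. emeasure \<eta> A = \<infinity> \<or> (\<exists>k::nat. emeasure \<eta> A = of_nat k))) \<and>
     (\<forall>A\<in>sets \<Lambda>. (\<lambda>\<eta>. emeasure \<eta> A) \<in> borel_measurable P) \<and>
     (\<forall>A\<in>sets \<Lambda>. emeasure \<Lambda> A < \<infinity> \<longrightarrow>
        (\<forall>k::nat. measure P {\<eta> \<in> space P. emeasure \<eta> A = of_nat k}
           = exp (- measure \<Lambda> A) * measure \<Lambda> A ^ k / fact k)) \<and>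
     (\<forall>A\<in>sets \<Lambda>. emeasure \<Lambda> A = \<infinity> \<longrightarrow> (AE \<eta> in P. emeasure \<eta> A = \<infinity>)) \<and>
     (\<forall>(I :: nat set) A. finite I \<and> A ` I \<subseteq> sets \<Lambda> \<and> disjoint_family_on A I \<longrightarrow>
        prob_space.indep_vars P (\<lambda>_. borel) (\<lambda>i \<eta>. emeasure \<eta> (A i)) I)"

definition open_edge :: "(int ^ 'd::finite) list set measure \<Rightarrow> int ^ 'd \<Rightarrow> int ^ 'd \<Rightarrow> bool" where
  "open_edge \<eta> x y \<longleftrightarrow> adj x y \<and> emeasure \<eta> {L \<in> loops. traverses L x y} \<ge> 1"

definition connected_to ::
    "(int ^ 'd::finite) list set measure \<Rightarrow> int ^ 'd \<Rightarrow> (int ^ 'd) set \<Rightarrow> bool" where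
  "connected_to \<eta> x A \<longleftrightarrow> (\<exists>y\<in>A. (open_edge \<eta>)\<^sup>*\<^sup>* x y)"

end

(*
  A chain of loops of growing diameter does better than a single loop. Loops of length in
  [4^k, 2 * 4^k) have diameter about 2^k, and the loop measure of those that meet a set of
  capacity C is of order C / 2^k. A typical loop of length L in three dimensions has capacity of
  order sqrt L. Start from the origin and go through the scales k = 1, 2, ..., M in turn, replacing
  the current loop by a loop of scale k of the point process that meets it, if there is one. From
  a loop of scale j this succeeds with probability at least of order 2^j / 2^k, and then multiplies
  the capacity by 2^k / 2^j; so every scale multiplies the expected capacity by a constant
  factor > 1. At the last scale 2^M ~ n, where the loop is also required to leave the box, a
  single loop would give probability 1 / n and the accumulated factor gives the extra n^epsilon.

  Capacity is replaced by the Green energy of the occupation measure of a loop, so that only a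
  second moment computation and the heat kernel bounds p_k <= C k^(-3/2), p_(2k)(0,0) >= c k^(-3/2)
  are needed.
*)

theory Submission
  imports Defs "HOL-Library.Poly_Mapping"
begin

section \<open>Binomial sums\<close>

text \<open>Each step of an exploration depends on the loops already seen, which would call for
  conditional laws of the point process. Instead the loop classes of all scales form one fixed list
  without repetition, and each is inspected at most once. Independence of the counts on singletons
  then gives an exact recursion for the success probability. The recursion is bounded from below by
  a potential: from a state \<open>\<kappa>\<close> before scale \<open>k\<close> the chance of
  success is at least \<open>gain \<alpha> / 2 ^ M * (1 + gain \<alpha> / 4) ^ (M - k) * sqrt
  (length \<kappa>)\<close>, so length stands for capacity. This is legitimate only for loops whose
  energy is at most of order length^(3/2), since capacity is at least length^2 / energy. Low energy
  is therefore demanded of every loop that the exploration enters, and Markov's inequality among the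
  bridges from a fixed point leaves a fixed share of them. The Green function is truncated at the
  same time \<open>2 * 4 ^ M\<close> for all scales, so that the energy bound known when a loop is
  entered can be used when it is left.\<close>

lemma central_binomial_even_upper: "(real ((2*m) choose m))\<^sup>2 * real (2*m+1) \<le> 16 ^ m"
proof (induction m)
  case 0 then show ?case by simp
next
  case (Suc m)
  have "(m+1) * ((2*Suc m) choose Suc m) = 2 * (2*m+1) * ((2*m) choose m)"
  proof -
    have a: "Suc (Suc (2*m)) * (Suc (2*m) choose m) = (Suc (Suc (2*m)) choose Suc m) * Suc m"
      and c: "Suc (2*m) * ((2*m) choose m) = (Suc (2*m) choose Suc m) * Suc m"
      by (rule Suc_times_binomial_eq)+
    have b: "(Suc (2*m) choose m) = (Suc (2*m) choose Suc m)"
      using binomial_symmetric[of m "Suc (2*m)"] by simp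
    have "A * Suc m = 2 * (2*m+1) * D"
      if "Suc (Suc (2*m)) * B = A * Suc m" "Suc (2*m) * D = B * Suc m" for A B D
      using that by (auto simp: algebra_simps)
    from this[OF a[unfolded b] c] show ?thesis by (simp add: mult.commute)
  qed
  then have e: "real (m+1) * real ((2*Suc m) choose Suc m) = 2 * real (2*m+1) * real ((2*m) choose m)"
    by (metis of_nat_mult of_nat_numeral)
  have "(real (m+1))\<^sup>2 * ((real ((2*Suc m) choose Suc m))\<^sup>2 * real (2*Suc m+1))
     = 4 * real (2*m+1) * real (2*m+3) * ((real ((2*m) choose m))\<^sup>2 * real (2*m+1))"
    using arg_cong[OF e, of "\<lambda>x. x\<^sup>2 * real (2*m+3)"] by (simp add: power2_eq_square algebra_simps)
  also have "\<dots> \<le> 4 * real (2*m+1) * real (2*m+3) * 16 ^ m"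
    by (intro mult_left_mono Suc) auto
  \<comment> \<open>The constants match because (2m+1)(2m+3) = (2m+2)^2 - 1.\<close>
  also have "\<dots> \<le> (real (m+1))\<^sup>2 * 16 ^ Suc m"
    by (simp add: power2_eq_square algebra_simps)
  finally show ?case by (rule mult_left_le_imp_le) simp
qed

text \<open>An odd row is settled by the next even one: the central coefficient of row 2m+2 is twice
  that of row 2m+1.\<close>

lemma central_binomial_upper: "(real (n choose (n div 2)))\<^sup>2 * real (n+1) \<le> 4 ^ n"
proof (cases "even n")
  case True
  then obtain m where "n = 2*m" by auto
  then show ?thesis using central_binomial_even_upper[of m] by (simp add: power_mult)
next
  case False
  then obtain m where n: "n = 2*m+1" using oddE by blast
  have "((2*m+1) choose m) = ((2*m+1) choose (Suc m))"
    using binomial_symmetric[of m "2*m+1"] by simp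
  then have "((2*Suc m) choose Suc m) = 2 * ((2*m+1) choose m)" by simp
  then have e: "real ((2*Suc m) choose Suc m) = 2 * real ((2*m+1) choose m)" by (metis of_nat_mult of_nat_numeral)
  have "4 * ((real (n choose (n div 2)))\<^sup>2 * real (n+1)) \<le> (real ((2*Suc m) choose Suc m))\<^sup>2 * real (2*Suc m+1)"
    unfolding e n by (simp add: power2_eq_square algebra_simps)
  also have "\<dots> \<le> 16 ^ Suc m" by (rule central_binomial_even_upper)
  also have "\<dots> = 4 * 4 ^ n" unfolding n by (simp add: power_mult)
  finally show ?thesis by simp
qed

text \<open>Divided by \<open>2 ^ n\<close>, this is the heat kernel bound for the walk on the
  integers.\<close>

lemma binomial_le_sqrt: "real (n choose j) \<le> 2 ^ n / sqrt (real n + 1)"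
proof -
  have "real (n choose j) \<le> real (n choose (n div 2))" using binomial_maximum by simp
  also have "\<dots> \<le> 2 ^ n / sqrt (real n + 1)"
  proof -
    have "real (n choose (n div 2)) * sqrt (real n + 1) = sqrt ((real (n choose (n div 2)))\<^sup>2 * real (n+1))"
      by (simp add: real_sqrt_mult add.commute)
    also have "\<dots> \<le> sqrt (4 ^ n)" using central_binomial_upper by (intro real_sqrt_le_mono)
    also have "\<dots> = 2 ^ n" by (simp add: real_sqrt_power)
    finally show ?thesis by (simp add: field_simps)
  qed
  finally show ?thesis .
qed

text \<open>Absorption: \<open>(m choose j) / (j + 1) = (Suc m choose Suc j) / (m + 1)\<close>, and
  the shifted coefficients sum to less than \<open>2 ^ (m + 1)\<close>.\<close>

lemma sum_binomial_div: "(\<Sum>j\<le>m. real (m choose j) / (real j + 1)) \<le> 2 * 2 ^ m / (real m + 1)"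
proof -
  have "(\<Sum>j\<le>m. real (m choose j) / (real j + 1)) = (\<Sum>j\<le>m. real (Suc m choose Suc j)) / (real m + 1)"
  proof -
    have "real (m choose j) / (real j + 1) = real (Suc m choose Suc j) / (real m + 1)" for j
    proof -
      have "real (Suc m) * real (m choose j) = real (Suc m choose Suc j) * real (Suc j)"
        using Suc_times_binomial_eq[of m j] by (metis of_nat_mult)
      then show ?thesis by (simp add: field_simps)
    qed
    then show ?thesis by (simp add: sum_divide_distrib)
  qed
  also have "(\<Sum>j\<le>m. real (Suc m choose Suc j)) \<le> (\<Sum>j\<le>Suc m. real (Suc m choose j))"
    by (subst sum.atMost_Suc_shift[of _ m]) simp
  also have "\<dots> = 2 ^ Suc m" by (metis choose_row_sum of_nat_numeral of_nat_power of_nat_sum)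
  finally show ?thesis by (simp add: divide_right_mono)
qed

text \<open>The inequality of the arithmetic and geometric means removes the square roots, so that
  absorption applies to the binomial sums.\<close>

lemma inv_sqrt_mult_le: "a > 0 \<Longrightarrow> b > 0 \<Longrightarrow> 1 / (sqrt a * sqrt b) \<le> (1/a + 1/b) / 2"
proof -
  assume "a > 0" "b > 0"
  then have "2 * ((1 / sqrt a) * (1 / sqrt b)) \<le> (1 / sqrt a)\<^sup>2 + (1 / sqrt b)\<^sup>2"
    using sum_squares_bound[of "1 / sqrt a" "1 / sqrt b"] by (simp add: mult.assoc)
  then show ?thesis using \<open>a > 0\<close> \<open>b > 0\<close> by (simp add: power_divide)
qed

text \<open>A binomial average, over the split of \<open>m\<close> steps between two axes, of the
  product of the one-dimensional bounds. It has the order 1/m of the planar heat kernel.\<close>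

lemma sum_binomial_inv_sqrt2:
  "(\<Sum>j\<le>m. real (m choose j) / (sqrt (real j + 1) * sqrt (real (m-j) + 1))) \<le> 2 * 2 ^ m / (real m + 1)"
proof -
  have "(\<Sum>j\<le>m. real (m choose j) / (sqrt (real j + 1) * sqrt (real (m-j) + 1)))
      \<le> (\<Sum>j\<le>m. real (m choose j) * ((1 / (real j + 1) + 1 / (real (m-j) + 1)) / 2))"
  proof (intro sum_mono)
    fix j
    show "real (m choose j) / (sqrt (real j + 1) * sqrt (real (m-j) + 1)) \<le>
        real (m choose j) * ((1 / (real j + 1) + 1 / (real (m-j) + 1)) / 2)"
      using mult_left_mono[OF inv_sqrt_mult_le[of "real j + 1" "real (m-j) + 1"], of "real (m choose j)"]
      by simp
  qed
  also have "\<dots> = ((\<Sum>j\<le>m. real (m choose j) / (real j + 1)) + (\<Sum>j\<le>m. real (m choose j) / (real (m-j) + 1))) / 2"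
    by (simp add: sum.distrib[symmetric] sum_divide_distrib algebra_simps)
  also have "(\<Sum>j\<le>m. real (m choose j) / (real (m-j) + 1)) = (\<Sum>j\<le>m. real (m choose j) / (real j + 1))"
    by (rule sum.reindex_bij_witness[of _ "\<lambda>j. m-j" "\<lambda>j. m-j"]) (auto simp: binomial_symmetric[symmetric])
  finally show ?thesis using sum_binomial_div[of m] by simp
qed

text \<open>The parameter \<open>K\<close> is free. Below it is \<open>k + 1\<close>, comparable to
  the typical number of steps along one axis out of \<open>k\<close>, so the inequality of means
  loses only a constant.\<close>

lemma inv_sqrt_le: "a > 0 \<Longrightarrow> K > 0 \<Longrightarrow> 1 / sqrt a \<le> (1 / sqrt K + sqrt K / a) / 2"
proof -
  assume "a > 0" "K > 0"
  then have "sqrt K * (1 / (sqrt a * sqrt K)) \<le> sqrt K * ((1/a + 1/K) / 2)"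
    by (intro mult_left_mono inv_sqrt_mult_le) auto
  moreover have "sqrt K * (1/K) = 1 / sqrt K" using \<open>K > 0\<close> by (simp add: field_simps flip: power2_eq_square)
  ultimately show ?thesis using \<open>a > 0\<close> \<open>K > 0\<close> by (simp add: distrib_left)
qed

lemma binomial_weight_sum: "(\<Sum>i\<le>n. real (n choose i) * 2 ^ (n-i)) = 3 ^ n"
  using binomial_ring[of "1::real" 2 n] by simp

lemma divide_scale_eq: "b / m = c / K \<Longrightarrow> b * p / m = c * (2 * p) / (2 * (K::real))"
proof -
  assume h: "b / m = c / K"
  have "b * p / m = b / m * p" by simp
  then show ?thesis unfolding h by simp
qed

text \<open>One axis receives \<open>i\<close> of the \<open>k\<close> steps and the planar bound
  covers the other \<open>k - i\<close>. After \<open>inv_sqrt_le\<close>, one absorption handles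
  the first sum and two handle the second; the constant is 6 = 3/2 + 9/2.\<close>

lemma sum_binomial_inv_sqrt3:
  "(\<Sum>i\<le>k. real (k choose i) * (2 * 2 ^ (k-i) / (real (k-i) + 1)) / sqrt (real i + 1))
     \<le> 6 * 3 ^ k / ((real k + 1) * sqrt (real k + 1))"
proof -
  define K where "K = real k + 1"
  have K: "K > 0" unfolding K_def by simp
  have s1: "(\<Sum>i\<le>k. real (k choose i) * 2 ^ (k-i) / (real (k-i) + 1)) \<le> 3 ^ (k+1) / (2 * K)"
  proof -
    have "real (k choose i) * 2 ^ (k-i) / (real (k-i) + 1) = real (Suc k choose i) * 2 ^ (Suc k-i) / (2*K)"
      if "i \<le> k" for i
    proof -
      have "Suc k * (k choose (k-i)) = (Suc k choose Suc (k-i)) * Suc (k-i)"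
        by (rule Suc_times_binomial_eq)
      moreover have "k choose (k-i) = k choose i" "Suc k choose Suc (k-i) = Suc k choose i"
        using that binomial_symmetric[of i k] binomial_symmetric[of i "Suc k"] by (auto simp: Suc_diff_le)
      ultimately have "real (Suc k) * real (k choose i) = real (Suc k choose i) * real (Suc (k-i))"
        by (metis of_nat_mult)
      then have "real (k choose i) / (real (k-i) + 1) = real (Suc k choose i) / K"
        unfolding K_def by (simp add: field_simps)
      then have "real (k choose i) * 2 ^ (k-i) / (real (k-i) + 1) = real (Suc k choose i) * (2 * 2 ^ (k-i)) / (2*K)"
        by (rule divide_scale_eq)
      moreover have "(2::real) ^ (Suc k - i) = 2 * 2 ^ (k-i)" using that by (simp add: Suc_diff_le)
      ultimately show ?thesis by (simp only:)
    qed
    then have "(\<Sum>i\<le>k. real (k choose i) * 2 ^ (k-i) / (real (k-i) + 1))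
       = (\<Sum>i\<le>k. real (Suc k choose i) * 2 ^ (Suc k-i)) / (2*K)"
      by (simp add: sum_divide_distrib)
    also have "(\<Sum>i\<le>k. real (Suc k choose i) * 2 ^ (Suc k-i)) \<le> (\<Sum>i\<le>Suc k. real (Suc k choose i) * 2 ^ (Suc k-i))"
      by (rule sum_mono2) auto
    also have "\<dots> = 3 ^ Suc k" by (rule binomial_weight_sum)
    finally show ?thesis using K by (simp add: divide_right_mono)
  qed
  have s2: "(\<Sum>i\<le>k. real (k choose i) * 2 ^ (k-i) / ((real (k-i) + 1) * (real i + 1))) \<le> 3 ^ (k+2) / (2 * K\<^sup>2)"
  proof -
    have "real (k choose i) * 2 ^ (k-i) / ((real (k-i) + 1) * (real i + 1))
        = real (Suc (Suc k) choose Suc i) * 2 ^ (Suc (Suc k) - Suc i) / (2 * (K * (K+1)))"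
      if "i \<le> k" for i
    proof -
      have "Suc k * (k choose (k-i)) = (Suc k choose Suc (k-i)) * Suc (k-i)"
        by (rule Suc_times_binomial_eq)
      moreover have "k choose (k-i) = k choose i" "Suc k choose Suc (k-i) = Suc k choose i"
        using that binomial_symmetric[of i k] binomial_symmetric[of i "Suc k"] by (auto simp: Suc_diff_le)
      ultimately have a: "real (Suc k) * real (k choose i) = real (Suc k choose i) * real (Suc (k-i))"
        by (metis of_nat_mult)
      have b: "real (Suc (Suc k)) * real (Suc k choose i) = real (Suc (Suc k) choose Suc i) * real (Suc i)"
        using Suc_times_binomial_eq[of "Suc k" i] by (metis of_nat_mult)
      have K1: "K = real (Suc k)" "K + 1 = real (Suc (Suc k))" unfolding K_def by auto
      have "real (Suc k) * real (Suc (Suc k)) * real (k choose i) = real (Suc (Suc k)) * (real (Suc k choose i) * real (Suc (k-i)))"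
        unfolding a[symmetric] by (simp only: mult_ac)
      also have "\<dots> = real (Suc (Suc k) choose Suc i) * real (Suc i) * real (Suc (k-i))"
        unfolding b[symmetric] by (simp only: mult_ac)
      finally have "real (k choose i) * (K * (K+1)) = real (Suc (Suc k) choose Suc i) * ((real (k-i) + 1) * (real i + 1))"
        unfolding K1 by (simp only: mult_ac of_nat_Suc add.commute)
      then have "real (k choose i) / ((real (k-i) + 1) * (real i + 1)) = real (Suc (Suc k) choose Suc i) / (K * (K+1))"
        using K by (subst frac_eq_eq) auto
      then have "real (k choose i) * 2 ^ (k-i) / ((real (k-i) + 1) * (real i + 1))
          = real (Suc (Suc k) choose Suc i) * (2 * 2 ^ (k-i)) / (2 * (K * (K+1)))"
        by (rule divide_scale_eq)
      moreover have "(2::real) ^ (Suc (Suc k) - Suc i) = 2 * 2 ^ (k-i)" using that by (simp add: Suc_diff_le)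
      ultimately show ?thesis by (simp only:)
    qed
    then have "(\<Sum>i\<le>k. real (k choose i) * 2 ^ (k-i) / ((real (k-i) + 1) * (real i + 1)))
       = (\<Sum>i\<le>k. real (Suc (Suc k) choose Suc i) * 2 ^ (Suc (Suc k) - Suc i)) / (2 * (K * (K+1)))"
      by (simp add: sum_divide_distrib)
    also have "(\<Sum>i\<le>k. real (Suc (Suc k) choose Suc i) * 2 ^ (Suc (Suc k) - Suc i))
       \<le> (\<Sum>i\<le>Suc (Suc k). real (Suc (Suc k) choose i) * 2 ^ (Suc (Suc k) - i))"
      by (subst sum.atMost_Suc_shift[of _ "Suc k"]) simp
    also have "\<dots> = 3 ^ Suc (Suc k)" by (rule binomial_weight_sum)
    finally have "(\<Sum>i\<le>k. real (k choose i) * 2 ^ (k-i) / ((real (k-i) + 1) * (real i + 1))) \<le> 3 ^ (k+2) / (2 * (K * (K+1)))"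
      using K by (simp add: divide_right_mono)
    also have "\<dots> \<le> 3 ^ (k+2) / (2 * K\<^sup>2)"
      using K by (intro frac_le) (auto simp: power2_eq_square distrib_left)
    finally show ?thesis .
  qed
  have "(\<Sum>i\<le>k. real (k choose i) * (2 * 2 ^ (k-i) / (real (k-i) + 1)) / sqrt (real i + 1))
     \<le> (\<Sum>i\<le>k. real (k choose i) * (2 * 2 ^ (k-i) / (real (k-i) + 1)) * ((1 / sqrt K + sqrt K / (real i + 1)) / 2))"
  proof (intro sum_mono)
    fix i
    show "real (k choose i) * (2 * 2 ^ (k-i) / (real (k-i) + 1)) / sqrt (real i + 1)
      \<le> real (k choose i) * (2 * 2 ^ (k-i) / (real (k-i) + 1)) * ((1 / sqrt K + sqrt K / (real i + 1)) / 2)"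
      using mult_left_mono[OF inv_sqrt_le[of "real i + 1" K], of "real (k choose i) * (2 * 2 ^ (k-i) / (real (k-i) + 1))"] K
      by simp
  qed
  also have "\<dots> = 1 / sqrt K * (\<Sum>i\<le>k. real (k choose i) * 2 ^ (k-i) / (real (k-i) + 1))
      + sqrt K * (\<Sum>i\<le>k. real (k choose i) * 2 ^ (k-i) / ((real (k-i) + 1) * (real i + 1)))"
  proof -
    have *: "b * (2 * c / m) * ((1 / s + q / n) / 2) = 1 / s * (b * c / m) + q * (b * c / (m * n))" for b c m s q n :: real
    proof -
      have "b * (2 * c / m) * ((1 / s + q / n) / 2) = b * c / m * (1 / s + q / n)" by simp
      then show ?thesis by (simp add: distrib_left mult_ac)
    qed
    show ?thesis unfolding * sum_distrib_left sum.distrib ..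
  qed
  also have "\<dots> \<le> 1 / sqrt K * (3 ^ (k+1) / (2 * K)) + sqrt K * (3 ^ (k+2) / (2 * K\<^sup>2))"
    using K by (intro add_mono mult_left_mono s1 s2) auto
  also have "\<dots> = 6 * 3 ^ k / (K * sqrt K)"
  proof -
    have "sqrt K * sqrt K = K" using K by simp
    then have "sqrt K / K\<^sup>2 = 1 / (K * sqrt K)" using K by (simp add: power2_eq_square field_simps)
    then show ?thesis using K
      by (simp add: field_simps power2_eq_square)
  qed
  finally show ?thesis unfolding K_def .
qed

section \<open>Simple random walk and its return probabilities\<close>

definition nbrs :: "(int ^ 3) set" where "nbrs = {e. adj 0 e}"

lemma nbrs_eq: "nbrs = (\<lambda>i. axis i 1) ` UNIV \<union> (\<lambda>i. axis i (- 1)) ` UNIV"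
proof -
  have "e \<in> nbrs \<longleftrightarrow> e \<in> {axis 1 1, axis 2 1, axis 3 1, axis 1 (-1), axis 2 (-1), axis 3 (-1)}" for e
  proof -
    have *: "a + b + c = 1 \<longleftrightarrow> (a = 1 \<and> b = 0 \<and> c = 0) \<or> (a = 0 \<and> b = 1 \<and> c = 0) \<or> (a = 0 \<and> b = 0 \<and> c = 1)"
      if "a \<ge> 0" "b \<ge> 0" "c \<ge> 0" for a b c :: int
      using that by arith
    have abs1: "\<bar>a\<bar> = 1 \<longleftrightarrow> a = 1 \<or> a = -1" for a :: int by arith
    then show ?thesis
      unfolding nbrs_def adj_def by (auto simp: sum_3 vec_eq_iff forall_3 axis_def * abs1)
  qed
  then have "nbrs = {axis 1 1, axis 2 1, axis 3 1, axis 1 (-1), axis 2 (-1), axis 3 (-1)}" by blast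
  then show ?thesis unfolding UNIV_3 by auto
qed

lemma finite_nbrs [simp]: "finite nbrs" unfolding nbrs_eq by simp

lemma sum_nbrs: "(\<Sum>e\<in>nbrs. f e) = (\<Sum>i\<in>UNIV. f (axis i 1) + f (axis i (- 1)))"
proof -
  have "inj (\<lambda>i::3. axis i (1::int))" "inj (\<lambda>i::3. axis i (- 1::int))"
    by (auto simp: inj_def axis_eq_axis)
  then show ?thesis unfolding nbrs_eq sum.distrib
    by (subst sum.union_disjoint) (auto simp: axis_eq_axis sum.reindex)
qed

lemma card_nbrs [simp]: "card nbrs = 6"
  using sum_nbrs[of "\<lambda>_. 1::nat"] by simp

lemma nbrs_minus: "- e \<in> nbrs \<longleftrightarrow> e \<in> nbrs"
  unfolding nbrs_def adj_def by simp

lemma adj_iff_nbrs: "adj x y \<longleftrightarrow> y - x \<in> nbrs"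
  unfolding nbrs_def adj_def by (simp add: abs_minus_commute)

fun srw :: "nat \<Rightarrow> int ^ 3 \<Rightarrow> int ^ 3 \<Rightarrow> real" where
  "srw 0 x y = of_bool (x = y)"
| "srw (Suc k) x y = (\<Sum>e\<in>nbrs. srw k (x + e) y) / 6"

text \<open>The walk in the group algebra of the lattice: as the steps along the three axes commute there,
  the binomial theorem reduces the transition probabilities to one dimension.\<close>

definition axis_step :: "3 \<Rightarrow> int ^ 3 \<Rightarrow>\<^sub>0 real" where
  "axis_step i = Poly_Mapping.single (axis i 1) 1 + Poly_Mapping.single (axis i (- 1)) 1"

lemma lookup_single_mult:
  fixes T :: "'a::ab_group_add \<Rightarrow>\<^sub>0 'b::comm_semiring_0"
  shows "Poly_Mapping.lookup (Poly_Mapping.single e c * T) v = c * Poly_Mapping.lookup T (v - e)"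
proof -
  have *: "v = l + q \<longleftrightarrow> v - l = q" for l q by (auto simp: algebra_simps)
  have "Poly_Mapping.lookup (Poly_Mapping.single e c * T) v = (\<Sum>l. c * Poly_Mapping.lookup T (v - l) when e = l)"
    unfolding lookup_mult lookup_single * by (simp add: when_mult)
  then show ?thesis by simp
qed

lemma srw_eq_lookup: "6 ^ k * srw k x y = Poly_Mapping.lookup ((\<Sum>i\<in>UNIV. axis_step i) ^ k) (y - x)"
proof (induction k arbitrary: x)
  case 0
  then show ?case by (simp add: lookup_one when_def)
next
  case (Suc k)
  have "6 ^ Suc k * srw (Suc k) x y = (\<Sum>e\<in>nbrs. 6 ^ k * srw k (x + e) y)"
    by (simp flip: sum_distrib_left)
  also have "\<dots> = (\<Sum>e\<in>nbrs. Poly_Mapping.lookup ((\<Sum>i\<in>UNIV. axis_step i) ^ k) (y - x - e))"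
    unfolding Suc by (simp add: algebra_simps)
  also have "\<dots> = Poly_Mapping.lookup ((\<Sum>i\<in>UNIV. axis_step i) * (\<Sum>i\<in>UNIV. axis_step i) ^ k) (y - x)"
    unfolding sum_nbrs sum_distrib_right
    by (simp add: lookup_sum axis_step_def distrib_right lookup_add lookup_single_mult)
  finally show ?case by simp
qed

lemma axis_add: "axis i a + axis i b = axis i (a + (b::int))"
  by (simp add: axis_def vec_eq_iff)

lemma axis_step_power:
  "axis_step i ^ a = (\<Sum>s\<le>a. Poly_Mapping.single (axis i (2 * int s - int a)) (real (a choose s)))"
proof -
  have pw: "Poly_Mapping.single (axis i c) 1 ^ n = Poly_Mapping.single (axis i (c * int n)) (1::real)" for c n
  proof (induction n)
    case 0
    then show ?case by (simp flip: single_one add: axis_def zero_vec_def)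
  next
    case (Suc n)
    then show ?case by (simp add: mult_single axis_add algebra_simps)
  qed
  have "axis_step i ^ a = (\<Sum>s\<le>a. of_nat (a choose s) * Poly_Mapping.single (axis i 1) 1 ^ s * Poly_Mapping.single (axis i (- 1)) 1 ^ (a - s))"
    unfolding axis_step_def by (rule binomial_ring)
  also have "\<dots> = (\<Sum>s\<le>a. Poly_Mapping.single (axis i (2 * int s - int a)) (real (a choose s)))"
  proof (intro sum.cong refl)
    fix s assume "s \<in> {..a}"
    then show "of_nat (a choose s) * Poly_Mapping.single (axis i 1) 1 ^ s * Poly_Mapping.single (axis i (- 1)) 1 ^ (a - s)
       = Poly_Mapping.single (axis i (2 * int s - int a)) (real (a choose s))"
      unfolding pw by (simp flip: single_of_nat add: mult_single axis_add of_nat_diff algebra_simps)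
  qed
  finally show ?thesis .
qed

text \<open>The displacement \<open>w\<close> after \<open>a\<close> steps determines the number
  \<open>s\<close> of positive steps, so at most one term survives.\<close>

lemma sum_when_le:
  assumes "\<And>s. f s \<le> M" "(0::real) \<le> M"
  shows "(\<Sum>s\<le>a. if 2 * int s - int a = w then f s else 0) \<le> M"
proof (cases "\<exists>s\<le>a. 2 * int s - int a = w")
  case True
  then obtain s0 where s0: "s0 \<le> a" "2 * int s0 - int a = w" by auto
  then have "2 * int s - int a = w \<longleftrightarrow> s = s0" for s by auto
  then show ?thesis using s0 assms by simp
next
  case False
  then have "(\<Sum>s\<le>a. if 2 * int s - int a = w then f s else 0) = 0" by (intro sum.neutral) auto
  then show ?thesis using assms by simp
qed

lemma sum_product3:
  fixes f g h :: "_ \<Rightarrow> 'a::semiring_0"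
  shows "sum f A * sum g B * sum h C = (\<Sum>s\<in>A. \<Sum>t\<in>B. \<Sum>u\<in>C. f s * g t * h u)"
proof -
  have "sum f A * sum g B * sum h C = sum f A * (\<Sum>t\<in>B. \<Sum>u\<in>C. g t * h u)"
    unfolding mult.assoc[of "sum f A"] sum_product[of g B h C] ..
  also have "\<dots> = (\<Sum>s\<in>A. f s * (\<Sum>t\<in>B. \<Sum>u\<in>C. g t * h u))" by (rule sum_distrib_right)
  also have "\<dots> = (\<Sum>s\<in>A. \<Sum>t\<in>B. \<Sum>u\<in>C. f s * g t * h u)"
    by (simp only: sum_distrib_left mult.assoc)
  finally show ?thesis .
qed

text \<open>Once the number of steps along each axis is prescribed, the coordinates are independent
  and the count is a product of binomial coefficients.\<close>

lemma lookup_axis_steps_le: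
  "Poly_Mapping.lookup (axis_step 1 ^ a * axis_step 2 ^ b * axis_step 3 ^ c) v
     \<le> 2 ^ (a+b+c) / (sqrt (real a + 1) * sqrt (real b + 1) * sqrt (real c + 1))"
proof -
  let ?F = "\<lambda>n w. \<Sum>s\<le>n. if 2 * int s - int n = w then real (n choose s) else 0"
  have F: "?F n w \<le> 2 ^ n / sqrt (real n + 1)" for n w
    by (rule sum_when_le) (use binomial_le_sqrt in auto)
  have F0: "?F n w \<ge> 0" for n w by (intro sum_nonneg) auto
  have ax: "axis 1 q + axis 2 r + axis 3 t = v \<longleftrightarrow> q = v$1 \<and> r = v$2 \<and> t = v$3" for q r t :: int
    by (auto simp: vec_eq_iff forall_3 axis_def)
  have "Poly_Mapping.lookup (axis_step 1 ^ a * axis_step 2 ^ b * axis_step 3 ^ c) v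
    = (\<Sum>s\<le>a. \<Sum>t\<le>b. \<Sum>u\<le>c. (if 2 * int s - int a = v$1 then real (a choose s) else 0) *
       (if 2 * int t - int b = v$2 then real (b choose t) else 0) * (if 2 * int u - int c = v$3 then real (c choose u) else 0))"
    unfolding axis_step_power sum_product3 mult_single lookup_sum lookup_single ax when_def
    by (intro sum.cong refl) simp
  also have "\<dots> = ?F a (v$1) * ?F b (v$2) * ?F c (v$3)"
    unfolding sum_product3 ..
  also have "\<dots> \<le> 2 ^ a / sqrt (real a + 1) * (2 ^ b / sqrt (real b + 1)) * (2 ^ c / sqrt (real c + 1))"
    by (intro mult_mono F F0 mult_nonneg_nonneg) auto
  finally show ?thesis by (simp add: power_add)
qed

text \<open>Expanding the power amounts to conditioning on the numbers of steps along the axes. The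
  inner sum is the planar one, the outer sum adds the third axis, and
  \<open>2 ^ k * 3 ^ k = 6 ^ k\<close> cancels the normalisation.\<close>

lemma srw_upper_sqrt: "srw k x y \<le> 6 / ((real k + 1) * sqrt (real k + 1))"
proof -
  let ?S = "\<Sum>i\<in>UNIV. axis_step i"
  have "?S ^ k = (axis_step 1 + (axis_step 2 + axis_step 3)) ^ k" by (simp add: sum_3 add.assoc)
  also have "\<dots> = (\<Sum>i\<le>k. of_nat (k choose i) * axis_step 1 ^ i * (axis_step 2 + axis_step 3) ^ (k-i))"
    by (rule binomial_ring)
  also have "\<dots> = (\<Sum>i\<le>k. \<Sum>j\<le>k-i. of_nat ((k choose i) * (k-i choose j)) * (axis_step 1 ^ i * axis_step 2 ^ j * axis_step 3 ^ (k-i-j)))"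
    unfolding binomial_ring[of "axis_step 2"] sum_distrib_left by (simp add: mult_ac)
  finally have e: "?S ^ k = \<dots>" .
  have l: "Poly_Mapping.lookup (of_nat n * T) v = real n * Poly_Mapping.lookup T v" for n and T :: "int ^ 3 \<Rightarrow>\<^sub>0 real" and v
    using lookup_single_mult[of 0 "real n" T v] by simp
  have "6 ^ k * srw k x y = (\<Sum>i\<le>k. \<Sum>j\<le>k-i. real ((k choose i) * (k-i choose j)) *
     Poly_Mapping.lookup (axis_step 1 ^ i * axis_step 2 ^ j * axis_step 3 ^ (k-i-j)) (y-x))"
    unfolding srw_eq_lookup e lookup_sum l ..
  also have "\<dots> \<le> (\<Sum>i\<le>k. \<Sum>j\<le>k-i. real ((k choose i) * (k-i choose j)) *
     (2 ^ k / (sqrt (real i + 1) * sqrt (real j + 1) * sqrt (real (k-i-j) + 1))))"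
  proof (intro sum_mono mult_left_mono)
    fix i j assume "i \<in> {..k}" "j \<in> {..k-i}"
    then have "i + j + (k-i-j) = k" by auto
    then show "Poly_Mapping.lookup (axis_step 1 ^ i * axis_step 2 ^ j * axis_step 3 ^ (k-i-j)) (y-x)
       \<le> 2 ^ k / (sqrt (real i + 1) * sqrt (real j + 1) * sqrt (real (k-i-j) + 1))"
      using lookup_axis_steps_le[of i j "k-i-j" "y-x"] by simp
  qed simp
  also have "\<dots> = (\<Sum>i\<le>k. 2 ^ k * (real (k choose i) / sqrt (real i + 1) *
      (\<Sum>j\<le>k-i. real (k-i choose j) / (sqrt (real j + 1) * sqrt (real (k-i-j) + 1)))))"
    unfolding sum_distrib_left by (simp add: mult_ac)
  also have "\<dots> \<le> (\<Sum>i\<le>k. 2 ^ k * (real (k choose i) / sqrt (real i + 1) * (2 * 2 ^ (k-i) / (real (k-i) + 1))))"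
    by (intro sum_mono mult_left_mono sum_binomial_inv_sqrt2) auto
  also have "\<dots> = 2 ^ k * (\<Sum>i\<le>k. real (k choose i) * (2 * 2 ^ (k-i) / (real (k-i) + 1)) / sqrt (real i + 1))"
    unfolding sum_distrib_left by (simp add: mult_ac)
  also have "\<dots> \<le> 2 ^ k * (6 * 3 ^ k / ((real k + 1) * sqrt (real k + 1)))"
    by (intro mult_left_mono sum_binomial_inv_sqrt3) auto
  also have "\<dots> = 6 ^ k * (6 / ((real k + 1) * sqrt (real k + 1)))"
    by (simp flip: power_mult_distrib)
  finally show ?thesis by (rule mult_left_le_imp_le) simp
qed

section \<open>Symmetries of the transition probabilities and Chapman-Kolmogorov\<close>

lemma srw_nonneg [simp]: "srw k x y \<ge> 0"
  by (induction k arbitrary: x) (auto intro: sum_nonneg)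

lemma srw_translate: "srw k (x + v) (y + v) = srw k x y"
proof (induction k arbitrary: x)
  case (Suc k)
  have "srw k (x + v + e) (y + v) = srw k (x + e) y" for e
    using Suc[of "x + e"] by (simp add: add_ac)
  then show ?case by simp
qed simp

lemma srw_reflect: "srw k (- x) (- y) = srw k x y"
proof (induction k arbitrary: x)
  case (Suc k)
  have "(\<Sum>e\<in>nbrs. srw k (- x + e) (- y)) = (\<Sum>e\<in>nbrs. srw k (x + e) y)"
    by (rule sum.reindex_bij_witness[of _ uminus uminus]) (auto simp: nbrs_minus simp flip: Suc)
  then show ?case by simp
qed simp

lemma srw_sym: "srw k x y = srw k y x"
proof -
  have "srw k x y = srw k (x - y) 0" using srw_translate[of k "x - y" y 0] by simp
  also have "\<dots> = srw k (y - x) 0" using srw_reflect[of k "x - y" 0] by simp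
  also have "\<dots> = srw k y x" using srw_translate[of k "y - x" x 0] by simp
  finally show ?thesis .
qed

lemma srw_diag: "srw k x x = srw k 0 0"
  using srw_translate[of k 0 x 0] by simp

text \<open>Only upper bounds are drawn from the Chapman-Kolmogorov identity, so a finite set of
  intermediate points is enough and summability over the lattice never arises.\<close>

lemma chapman_kolmogorov_le:
  assumes "finite Y"
  shows "(\<Sum>y\<in>Y. srw a x y * srw b y z) \<le> srw (a + b) x z"
proof (induction a arbitrary: x)
  case 0
  have "(\<Sum>y\<in>Y. of_bool (x = y) * srw b y z) = (if x \<in> Y then srw b x z else 0)"
    using assms by (simp add: of_bool_def if_distrib[of "\<lambda>t. t * _"] cong: if_cong)
  then show ?case by simp
next
  case (Suc a)
  have "(\<Sum>y\<in>Y. srw (Suc a) x y * srw b y z) = (\<Sum>e\<in>nbrs. \<Sum>y\<in>Y. srw a (x + e) y * srw b y z) / 6"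
    by (subst sum.swap) (simp add: sum_distrib_right sum_divide_distrib)
  also have "\<dots> \<le> (\<Sum>e\<in>nbrs. srw (a + b) (x + e) z) / 6"
    by (intro divide_right_mono sum_mono Suc) auto
  finally show ?case by simp
qed

section \<open>Lower bound for the return probability\<close>

text \<open>The mean of \<open>f\<close> at time \<open>k\<close> of the walk from \<open>x\<close>,
  as an iterated average over neighbours. No sum over end points appears, so unbounded functions
  such as \<open>norm2\<close> raise no summability question.\<close>

definition walk_mean :: "nat \<Rightarrow> (int ^ 3 \<Rightarrow> real) \<Rightarrow> int ^ 3 \<Rightarrow> real" where
  "walk_mean k f = ((\<lambda>g x. (\<Sum>e\<in>nbrs. g (x + e)) / 6) ^^ k) f"

lemma walk_mean_0 [simp]: "walk_mean 0 f x = f x"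
  and walk_mean_Suc [simp]: "walk_mean (Suc k) f x = (\<Sum>e\<in>nbrs. walk_mean k f (x + e)) / 6"
  by (simp_all add: walk_mean_def)

lemma walk_mean_indicator:
  assumes "finite Y"
  shows "walk_mean k (\<lambda>z. of_bool (z \<in> Y)) x = (\<Sum>y\<in>Y. srw k x y)"
proof (induction k arbitrary: x)
  case 0
  then show ?case using assms by (simp add: of_bool_def)
next
  case (Suc k)
  then show ?case using sum.swap[of "\<lambda>e y. srw k (x+e) y" Y nbrs] by (simp add: sum_divide_distrib)
qed

lemma walk_mean_mono: "(\<And>z. f z \<le> g z) \<Longrightarrow> walk_mean k f x \<le> walk_mean k g x"
  by (induction k arbitrary: x) (auto intro!: sum_mono divide_right_mono)

lemma walk_mean_affine: "walk_mean k (\<lambda>z. a * f z + b) x = a * walk_mean k f x + b"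
proof (induction k arbitrary: x)
  case (Suc k)
  then show ?case by (simp add: sum.distrib sum_distrib_left add_divide_distrib)
qed simp

definition norm2 :: "int ^ 3 \<Rightarrow> real" where "norm2 z = (\<Sum>i\<in>UNIV. (real_of_int (z $ i))\<^sup>2)"

lemma sum_norm2_nbrs: "(\<Sum>e\<in>nbrs. norm2 (x + e)) = 6 * norm2 x + 6"
  unfolding sum_nbrs norm2_def
  by (simp add: sum_3 axis_def power2_eq_square algebra_simps)

lemma walk_mean_norm2: "walk_mean k norm2 x = norm2 x + real k"
proof (induction k arbitrary: x)
  case (Suc k)
  then show ?case by (simp add: sum.distrib sum_norm2_nbrs add_divide_distrib)
qed simp

lemma mem_lattice_box: "y \<in> lattice_box x n \<longleftrightarrow> (\<forall>i. \<bar>y $ i - x $ i\<bar> \<le> int n)" for x y :: "int ^ 'd"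
  unfolding lattice_box_def sup_norm_def by (subst mem_Collect_eq, subst Max_le_iff) auto

lemma finite_lattice_box: "finite (lattice_box x n :: (int ^ 3) set)"
  and card_lattice_box: "card (lattice_box x n :: (int ^ 3) set) \<le> (2 * n + 1) ^ 3"
proof -
  define I where "I i = {x $ i - int n..x $ i + int n}" for i
  define h where "h = (\<lambda>(a, b, c). (\<chi> i. if i = 1 then a else if i = 2 then b else c) :: int ^ 3)"
  have sub: "lattice_box x n \<subseteq> h ` (I 1 \<times> I 2 \<times> I 3)"
  proof
    fix z assume "z \<in> lattice_box x n"
    then have "z $ i \<in> I i" for i unfolding mem_lattice_box I_def atLeastAtMost_iff abs_le_iff
      by (metis add.commute diff_le_eq minus_diff_eq)
    moreover have "z = h (z $ 1, z $ 2, z $ 3)"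
      unfolding h_def by (auto simp: vec_eq_iff forall_3)
    ultimately show "z \<in> h ` (I 1 \<times> I 2 \<times> I 3)" by blast
  qed
  have fin: "finite (I 1 \<times> I 2 \<times> I 3)" unfolding I_def by simp
  then show "finite (lattice_box x n)" using sub finite_subset by blast
  have "card (lattice_box x n) \<le> card (I 1 \<times> I 2 \<times> I 3)"
    using card_mono[OF _ sub] card_image_le[OF fin, of h] fin by (meson finite_imageI order_trans)
  also have "\<dots> = (2 * n + 1) ^ 3"
  proof -
    have "card (I i) = 2 * n + 1" for i unfolding I_def by simp
    then show ?thesis by (simp add: card_cartesian_product power3_eq_cube)
  qed
  finally show "card (lattice_box x n) \<le> (2 * n + 1) ^ 3" .
qed

lemma finite_card_norm2_ball:
  fixes R :: real assumes "R \<ge> 0"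
  shows "finite {z. norm2 z \<le> R\<^sup>2}" "real (card {z. norm2 z \<le> R\<^sup>2}) \<le> (2 * R + 1) ^ 3"
proof -
  define n where "n = nat \<lfloor>R\<rfloor>"
  have sub: "{z. norm2 z \<le> R\<^sup>2} \<subseteq> lattice_box 0 n"
  proof
    fix z assume "z \<in> {z. norm2 z \<le> R\<^sup>2}"
    then have le: "norm2 z \<le> R\<^sup>2" by simp
    have "\<bar>z $ i\<bar> \<le> int n" for i
    proof -
      have "(real_of_int (z $ i))\<^sup>2 \<le> norm2 z"
        unfolding norm2_def by (rule member_le_sum) auto
      then have "(real_of_int (z $ i))\<^sup>2 \<le> R\<^sup>2" using le by simp
      then have "\<bar>real_of_int (z $ i)\<bar> \<le> R" using assms by (metis abs_le_square_iff abs_of_nonneg)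
      then have "real_of_int \<bar>z $ i\<bar> \<le> R" by simp
      then have "\<bar>z $ i\<bar> \<le> \<lfloor>R\<rfloor>" by (simp only: le_floor_iff)
      then show ?thesis unfolding n_def using assms by simp
    qed
    then show "z \<in> lattice_box 0 n" unfolding mem_lattice_box by simp
  qed
  then show "finite {z. norm2 z \<le> R\<^sup>2}" using finite_lattice_box finite_subset by blast
  have "card {z. norm2 z \<le> R\<^sup>2} \<le> (2 * n + 1) ^ 3"
    using card_mono[OF finite_lattice_box sub] card_lattice_box le_trans by blast
  then have "real (card {z. norm2 z \<le> R\<^sup>2}) \<le> real ((2 * n + 1) ^ 3)" by (simp only: of_nat_le_iff)
  also have "\<dots> = (2 * real n + 1) ^ 3" by (simp only: of_nat_power of_nat_add of_nat_mult of_nat_numeral of_nat_1)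
  also have "\<dots> \<le> (2 * R + 1) ^ 3"
    unfolding n_def using assms by (intro power_mono) auto
  finally show "real (card {z. norm2 z \<le> R\<^sup>2}) \<le> (2 * R + 1) ^ 3" .
qed

text \<open>By Chebyshev at least half of the mass at time \<open>m\<close> lies in a ball with at
  most \<open>27 R^3\<close> points. By Cauchy-Schwarz and symmetry, mass confined in this way
  forces a return probability of order \<open>R^(-3)\<close> at time \<open>2m\<close>; 108 = 4 *
  27.\<close>

lemma srw_return_lower: "srw (2 * m) x x \<ge> 1 / (108 * (real (2*m+1) * sqrt (real (2*m+1))))"
proof -
  define R where "R = sqrt (real (2 * m + 1))"
  define Y where "Y = {z. norm2 z \<le> R\<^sup>2}"
  have R: "R \<ge> 1" "R\<^sup>2 = real (2*m+1)" unfolding R_def by auto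
  have fin: "finite Y" and card: "real (card Y) \<le> (2 * R + 1) ^ 3"
    unfolding Y_def using finite_card_norm2_ball[of R] R by auto
  have n0: "norm2 z \<ge> 0" for z unfolding norm2_def by (intro sum_nonneg) auto
  \<comment> \<open>Chebyshev in pointwise form: the quadratic function lies below the indicator of
    the ball, and its mean is known exactly.\<close>
  have "walk_mean m (\<lambda>z. (- 1 / R\<^sup>2) * norm2 z + 1) 0 \<le> walk_mean m (\<lambda>z. of_bool (z \<in> Y)) 0"
  proof (rule walk_mean_mono)
    fix z
    have "R\<^sup>2 > 0" using R by simp
    then show "(- 1 / R\<^sup>2) * norm2 z + 1 \<le> of_bool (z \<in> Y)"
      unfolding Y_def using n0[of z] by (auto simp: of_bool_def field_simps)
  qed
  also have "\<dots> = (\<Sum>y\<in>Y. srw m 0 y)" by (rule walk_mean_indicator[OF fin])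
  finally have "1 - real m / R\<^sup>2 \<le> (\<Sum>y\<in>Y. srw m 0 y)"
    unfolding walk_mean_affine walk_mean_norm2 by (simp add: norm2_def)
  moreover have "1 - real m / R\<^sup>2 \<ge> 1/2" unfolding R(2) by (simp add: field_simps)
  ultimately have half: "1/2 \<le> (\<Sum>y\<in>Y. srw m 0 y)" by simp
  have "(1/2)\<^sup>2 \<le> (\<Sum>y\<in>Y. srw m 0 y)\<^sup>2" using half by (intro power_mono) auto
  also have "\<dots> \<le> (\<Sum>y\<in>Y. (srw m 0 y)\<^sup>2) * (\<Sum>y\<in>Y. 1\<^sup>2)"
    using Cauchy_Schwarz_ineq_sum[of "\<lambda>y. srw m 0 y" "\<lambda>_. 1" Y] by simp
  also have "\<dots> = (\<Sum>y\<in>Y. srw m 0 y * srw m y 0) * real (card Y)"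
    by (simp add: power2_eq_square srw_sym[of m _ 0])
  also have "\<dots> \<le> srw (m + m) 0 0 * (2 * R + 1) ^ 3"
    by (intro mult_mono chapman_kolmogorov_le fin card) auto
  also have "\<dots> \<le> srw (m + m) 0 0 * (27 * R ^ 3)"
  proof -
    have "(2 * R + 1) ^ 3 \<le> (3 * R) ^ 3" using R by (intro power_mono) auto
    then show ?thesis by (intro mult_left_mono) (auto simp: power_mult_distrib)
  qed
  finally have "1 \<le> srw (2 * m) x x * (108 * R ^ 3)"
    unfolding srw_diag[of _ x] mult_2[symmetric] by (simp add: power2_eq_square)
  moreover have "R ^ 3 = real (2*m+1) * sqrt (real (2*m+1))"
    unfolding R_def by (simp add: power3_eq_cube)
  ultimately have "1 \<le> srw (2 * m) x x * (108 * (real (2*m+1) * sqrt (real (2*m+1))))" by (simp only:)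
  then show ?thesis by (subst pos_divide_le_eq) (auto intro!: mult_pos_pos)
qed

section \<open>Bounds in powers n^(3/2) for the walk, its bridges and the Green function\<close>

definition pow32 :: "nat \<Rightarrow> real" where "pow32 n = real n * sqrt (real n)"

lemma pow32_nonneg [simp]: "pow32 n \<ge> 0" unfolding pow32_def by simp

lemma pow32_pos [simp]: "n > 0 \<Longrightarrow> pow32 n > 0" unfolding pow32_def by simp

lemma pow32_mono: "m \<le> n \<Longrightarrow> pow32 m \<le> pow32 n"
  unfolding pow32_def by (intro mult_mono) auto

lemma pow32_double_le: "m \<le> 2 * n \<Longrightarrow> pow32 m \<le> 3 * pow32 n"
proof -
  assume "m \<le> 2 * n"
  then have "pow32 m \<le> pow32 (2 * n)" by (rule pow32_mono)
  also have "\<dots> = 2 * sqrt 2 * pow32 n" unfolding pow32_def by (simp add: real_sqrt_mult)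
  also have "\<dots> \<le> 3 * pow32 n"
  proof (rule mult_right_mono)
    have "sqrt 2 \<le> sqrt ((3/2)\<^sup>2)" by (intro real_sqrt_le_mono) (simp add: power2_eq_square)
    then show "2 * sqrt 2 \<le> (3::real)" by simp
  qed simp
  finally show ?thesis .
qed

lemma srw_upper: "srw k x y \<le> 6 / pow32 (Suc k)"
  using srw_upper_sqrt[of k x y] by (simp add: pow32_def add.commute)

text \<open>Here 324 = 3 * 108, the factor 3 paying for the passage from \<open>Suc L\<close> to
  \<open>L\<close>.\<close>

lemma srw_return_even_lower:
  assumes "even L" "L > 0" shows "srw L x x \<ge> 1 / (324 * pow32 L)"
proof -
  obtain m where m: "L = 2 * m" using assms by auto
  have "1 / (324 * pow32 L) \<le> 1 / (108 * pow32 (Suc L))"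
    using assms pow32_double_le[of "Suc L" L] by (intro divide_left_mono) auto
  also have "\<dots> \<le> srw L x x" using srw_return_lower[of m x] unfolding m pow32_def by simp
  finally show ?thesis .
qed

text \<open>One of the two legs takes about half of the time or more and is therefore at most
  \<open>18 / pow32 L\<close>, with 18 = 3 * 6; the other leg is kept. Bridges are thereby compared
  with free walks.\<close>

lemma srw_bridge_le:
  assumes "i \<le> L" "L > 0"
  shows "srw i x y * srw (L - i) u v \<le> 18 / pow32 L * (srw i x y + srw (L - i) u v)"
proof -
  have small: "srw j a b \<le> 18 / pow32 L" if "L \<le> 2 * Suc j" for j a b
  proof -
    have "srw j a b \<le> 6 / pow32 (Suc j)" by (rule srw_upper)
    also have "\<dots> \<le> 18 / pow32 L"
      using pow32_double_le[OF that] assms by (simp add: field_simps)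
    finally show ?thesis .
  qed
  show ?thesis
  proof (cases "L \<le> 2 * Suc i")
    case True
    then have "srw i x y * srw (L - i) u v \<le> 18 / pow32 L * srw (L - i) u v"
      by (intro mult_right_mono small) auto
    also have "\<dots> \<le> 18 / pow32 L * (srw i x y + srw (L - i) u v)"
      by (intro mult_left_mono) auto
    finally show ?thesis .
  next
    case False
    then have "srw i x y * srw (L - i) u v \<le> srw i x y * (18 / pow32 L)"
      by (intro mult_left_mono small) auto
    also have "\<dots> \<le> 18 / pow32 L * (srw i x y + srw (L - i) u v)"
      by (subst mult.commute) (intro mult_left_mono, auto)
    finally show ?thesis .
  qed
qed

text \<open>Telescoping: with \<open>a = sqrt n\<close> and \<open>b = sqrt (n + 1)\<close> one has
  \<open>1/a - 1/b = 1 / (a * b * (a + b))\<close>, and \<open>b \<le> 3/2 * a\<close> makes the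
  denominator at most \<open>4 * a^3\<close>.\<close>

lemma sum_inv_pow32: "(\<Sum>k<K. 1 / pow32 (Suc (r + k))) \<le> 4 / sqrt (real (Suc r))"
proof -
  have step: "1 / pow32 n \<le> 4 * (1 / sqrt (real n) - 1 / sqrt (real (Suc n)))" if "n > 0" for n
  proof -
    define a b where "a = sqrt (real n)" and "b = sqrt (real (Suc n))"
    have a: "a > 0" "a\<^sup>2 = real n" and b: "b > 0" "b\<^sup>2 = a\<^sup>2 + 1" using that by (auto simp: a_def b_def)
    have "a \<ge> 1" using that unfolding a_def by simp
    then have "a\<^sup>2 \<ge> 1" by simp
    have "(3/2 * a)\<^sup>2 = 9/4 * a\<^sup>2" by (simp add: power2_eq_square)
    then have "b\<^sup>2 \<le> (3/2 * a)\<^sup>2" using b(2) \<open>a\<^sup>2 \<ge> 1\<close> by linarith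
    then have ba: "b \<le> 3/2 * a" by (rule power2_le_imp_le) (use a(1) in simp)
    have "1 / a - 1 / b = (b - a) / (a * b)" using a(1) b(1) by (simp add: diff_frac_eq)
    also have "b - a = 1 / (a + b)"
    proof -
      have "(b - a) * (a + b) = b\<^sup>2 - a\<^sup>2" by (simp add: power2_eq_square algebra_simps)
      then have "(b - a) * (a + b) = 1" using b(2) by simp
      then show ?thesis using a(1) b(1) by (simp add: eq_divide_eq)
    qed
    finally have e: "1 / a - 1 / b = 1 / (a + b) / (a * b)" .
    have "(a + b) * (a * b) \<le> (5/2 * a) * (a * (3/2 * a))"
      using ba a(1) b(1) by (intro mult_mono) auto
    also have "\<dots> \<le> 4 * (a\<^sup>2 * a)" using a(1) by (simp add: power2_eq_square)
    finally have "1 / (4 * (a\<^sup>2 * a)) \<le> 1 / ((a + b) * (a * b))"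
      using a(1) b(1) by (intro divide_left_mono) auto
    moreover have "1 / (a\<^sup>2 * a) = 4 * (1 / (4 * (a\<^sup>2 * a)))" by simp
    ultimately have "1 / (a\<^sup>2 * a) \<le> 4 * (1 / ((a + b) * (a * b)))"
      using mult_left_mono[of "1 / (4 * (a\<^sup>2 * a))" "1 / ((a + b) * (a * b))" 4] by simp
    moreover have "pow32 n = a\<^sup>2 * a" unfolding pow32_def a(2) by (simp add: a_def)
    ultimately have "1 / pow32 n \<le> 4 * (1 / a - 1 / b)" unfolding e by simp
    then show ?thesis unfolding a_def b_def .
  qed
  have "(\<Sum>k<K. 1 / pow32 (Suc (r + k))) \<le> (\<Sum>k<K. 4 * (1 / sqrt (real (Suc (r+k))) - 1 / sqrt (real (Suc (r + Suc k)))))"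
    by (intro sum_mono) (simp only: add_Suc_right step zero_less_Suc)
  also have "\<dots> = 4 * (1 / sqrt (real (Suc r)) - 1 / sqrt (real (Suc (r + K))))"
    unfolding sum_distrib_left[symmetric]
    using sum_lessThan_telescope'[of "\<lambda>k. 1 / sqrt (real (Suc (r+k)))" K] by simp
  also have "\<dots> \<le> 4 / sqrt (real (Suc r))" by simp
  finally show ?thesis .
qed

text \<open>Truncating the Green function at a large time \<open>K\<close> avoids infinite sums; no bound below depends
  on \<open>K\<close>.\<close>

definition green :: "nat \<Rightarrow> int ^ 3 \<Rightarrow> int ^ 3 \<Rightarrow> real" where
  "green K x y = (\<Sum>k<K. srw k x y)"

lemma green_nonneg [simp]: "green K x y \<ge> 0"
  unfolding green_def by (intro sum_nonneg) auto

lemma green_translate: "green K (x + v) (y + v) = green K x y"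
  unfolding green_def srw_translate ..

text \<open>By Chapman-Kolmogorov, \<open>m\<close> steps away from \<open>x\<close> followed by a
  Green function back to \<open>x\<close> are at most the return probabilities summed from time
  \<open>m\<close> on, a tail of order \<open>1 / sqrt m\<close>.\<close>

lemma sum_srw_green_le:
  assumes "finite Y"
  shows "(\<Sum>y\<in>Y. srw m x y * green K x y) \<le> 24 / sqrt (real (Suc m))"
proof -
  have "(\<Sum>y\<in>Y. srw m x y * green K x y) = (\<Sum>k<K. \<Sum>y\<in>Y. srw m x y * srw k y x)"
    unfolding green_def sum_distrib_left by (subst sum.swap) (simp add: srw_sym[of _ _ x])
  also have "\<dots> \<le> (\<Sum>k<K. srw (m + k) x x)" by (intro sum_mono chapman_kolmogorov_le assms)
  also have "\<dots> \<le> (\<Sum>k<K. 6 * (1 / pow32 (Suc (m + k))))" using srw_upper by (intro sum_mono) simp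
  also have "\<dots> \<le> 6 * (4 / sqrt (real (Suc m)))"
    unfolding sum_distrib_left[symmetric] by (intro mult_left_mono sum_inv_pow32) auto
  finally show ?thesis by simp
qed

lemma green_le: "green K x y \<le> 24"
proof -
  have "green K x y \<le> (\<Sum>k<K. 6 * (1 / pow32 (Suc (0 + k))))"
    unfolding green_def using srw_upper by (intro sum_mono) simp
  also have "\<dots> \<le> 6 * (4 / sqrt (real (Suc 0)))"
    unfolding sum_distrib_left[symmetric] by (intro mult_left_mono sum_inv_pow32) auto
  finally show ?thesis by simp
qed

lemma sum_bridge_le_green:
  assumes "L > 0" "K > L"
  shows "(\<Sum>i<L. srw i x y * srw (L - i) y x) \<le> 36 / pow32 L * green K x y"
proof -
  have "(\<Sum>i<L. srw i x y * srw (L - i) y x) \<le> (\<Sum>i<L. 18 / pow32 L * (srw i x y + srw (L - i) x y))"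
    using srw_bridge_le[of _ L x y] assms by (intro sum_mono) (auto simp: srw_sym[of _ y x])
  also have "\<dots> = 18 / pow32 L * ((\<Sum>i<L. srw i x y) + (\<Sum>i<L. srw (L - i) x y))"
    by (simp only: sum_distrib_left[symmetric] sum.distrib)
  \<comment> \<open>Time reversal turns the range \<open>{..<L}\<close> into \<open>{1..L}\<close>.
    The term at \<open>L\<close> is the reason for \<open>K > L\<close> instead of
    \<open>K \<ge> L\<close>.\<close>
  also have "(\<Sum>i<L. srw (L - i) x y) = (\<Sum>i\<in>{1..L}. srw i x y)"
    by (rule sum.reindex_bij_witness[of _ "\<lambda>i. L - i" "\<lambda>i. L - i"]) auto
  also have "18 / pow32 L * ((\<Sum>i<L. srw i x y) + (\<Sum>i\<in>{1..L}. srw i x y))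
      \<le> 18 / pow32 L * (green K x y + green K x y)"
    unfolding green_def by (intro mult_left_mono add_mono sum_mono2) (use assms in auto)
  finally show ?thesis by simp
qed

lemma sum_inv_sqrt_le: "(\<Sum>m<L. 1 / sqrt (real (Suc m))) \<le> 2 * sqrt (real L)"
proof (induction L)
  case (Suc L)
  define a b where "a = sqrt (real L)" and "b = sqrt (real (Suc L))"
  have b: "b > 0" "b * b = a * a + 1" "a \<ge> 0" unfolding a_def b_def by auto
  have "2 * a * b \<le> a * a + b * b" using sum_squares_bound[of a b] by (simp add: power2_eq_square)
  then have "2 * a * b + 1 \<le> 2 * (b * b)" using b by simp
  then have "2 * a + 1 / b \<le> 2 * b" using b by (simp add: field_simps)
  then show ?case using Suc unfolding a_def b_def by simp
qed simp

section \<open>Closed walks\<close>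

fun walks :: "nat \<Rightarrow> int ^ 3 \<Rightarrow> (int ^ 3) list set" where
  "walks 0 x = {[x]}"
| "walks (Suc k) x = (\<Union>e\<in>nbrs. Cons x ` walks k (x + e))"

lemma walks_iff:
  "l \<in> walks k x \<longleftrightarrow> length l = Suc k \<and> l ! 0 = x \<and> (\<forall>i<k. adj (l ! i) (l ! Suc i))"
proof (induction k arbitrary: x l)
  case 0
  then show ?case by (cases l) auto
next
  case (Suc k)
  have "l \<in> walks (Suc k) x \<longleftrightarrow> (\<exists>l'. l = x # l' \<and> adj x (l' ! 0) \<and> l' \<in> walks k (l' ! 0))"
  proof
    assume "l \<in> walks (Suc k) x"
    then obtain e l' where "e \<in> nbrs" "l = x # l'" "l' \<in> walks k (x + e)" by auto
    moreover then have "l' ! 0 = x + e" using Suc by blast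
    ultimately show "\<exists>l'. l = x # l' \<and> adj x (l' ! 0) \<and> l' \<in> walks k (l' ! 0)"
      by (auto simp: adj_iff_nbrs)
  next
    assume "\<exists>l'. l = x # l' \<and> adj x (l' ! 0) \<and> l' \<in> walks k (l' ! 0)"
    then obtain l' where l': "l = x # l'" "l' ! 0 - x \<in> nbrs" "l' \<in> walks k (x + (l' ! 0 - x))"
      by (auto simp: adj_iff_nbrs)
    then show "l \<in> walks (Suc k) x" by (simp only: walks.simps) blast
  qed
  also have "\<dots> \<longleftrightarrow> length l = Suc (Suc k) \<and> l ! 0 = x \<and> (\<forall>i<Suc k. adj (l ! i) (l ! Suc i))"
    unfolding Suc by (cases l) (auto simp: All_less_Suc2)
  finally show ?case .
qed

lemma finite_walks [simp]: "finite (walks k x)"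
  by (induction k arbitrary: x) auto

lemma card_walks_Suc:
  "card {l \<in> walks (Suc k) x. R l} = (\<Sum>e\<in>nbrs. card {l \<in> walks k (x + e). R (x # l)})"
proof -
  have "{l \<in> walks (Suc k) x. R l} = (\<Union>e\<in>nbrs. Cons x ` {l \<in> walks k (x + e). R (x # l)})" by auto
  also have "card \<dots> = (\<Sum>e\<in>nbrs. card (Cons x ` {l \<in> walks k (x + e). R (x # l)}))"
  proof (rule card_UN_disjoint)
    show "\<forall>i\<in>nbrs. \<forall>j\<in>nbrs. i \<noteq> j \<longrightarrow> Cons x ` {l \<in> walks k (x + i). R (x # l)} \<inter> Cons x ` {l \<in> walks k (x + j). R (x # l)} = {}"
      by (auto simp: walks_iff)
  qed simp_all
  finally show ?thesis by (simp add: card_image)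
qed

lemma card_walks_end: "real (card {l \<in> walks b x. l ! b = z}) = 6 ^ b * srw b x z"
proof (induction b arbitrary: x)
  case 0
  have "{l. l = [x] \<and> l ! 0 = z} = (if x = z then {[x]} else {})" by auto
  then show ?case by simp
next
  case (Suc b)
  then show ?case unfolding card_walks_Suc by (simp flip: sum_distrib_left)
qed

lemma card_walks_mid:
  "real (card {l \<in> walks (a + b) x. l ! a = y \<and> l ! (a + b) = z}) = 6 ^ (a + b) * (srw a x y * srw b y z)"
proof (induction a arbitrary: x)
  case 0
  have "{l \<in> walks b x. l ! 0 = y \<and> l ! b = z} = (if x = y then {l \<in> walks b x. l ! b = z} else {})"
    by (auto simp: walks_iff)
  then show ?case by (simp add: card_walks_end)
next
  case (Suc a)
  have "real (card {l \<in> walks (Suc a + b) x. l ! Suc a = y \<and> l ! (Suc a + b) = z})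
      = (\<Sum>e\<in>nbrs. real (card {l \<in> walks (a + b) (x + e). l ! a = y \<and> l ! (a + b) = z}))"
    using card_walks_Suc[of "a + b" x "\<lambda>l. l ! Suc a = y \<and> l ! (Suc a + b) = z"] by simp
  also have "\<dots> = (\<Sum>e\<in>nbrs. 6 ^ (a + b) * (srw a (x + e) y * srw b y z))" unfolding Suc ..
  also have "\<dots> = 6 ^ (Suc a + b) * (srw (Suc a) x y * srw b y z)"
    by (simp add: sum_distrib_left sum_distrib_right mult_ac)
  finally show ?case .
qed

text \<open>As for based loops, the list does not repeat its first entry at the end, so rotations
  act on it.\<close>

definition closed_walks :: "nat \<Rightarrow> (int ^ 3) list set" where
  "closed_walks L = {l. length l = L \<and> (\<forall>i<L. adj (l ! i) (l ! (Suc i mod L)))}"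

definition bridges :: "nat \<Rightarrow> int ^ 3 \<Rightarrow> (int ^ 3) list set" where
  "bridges L x = {l \<in> closed_walks L. l ! 0 = x}"

text \<open>Appending the starting point opens the cyclic list into a walk of \<open>L\<close>
  steps, for which the counts are known.\<close>

lemma bij_betw_bridges_walks:
  assumes "m < L"
  shows "bij_betw (\<lambda>l. l @ [x]) {l \<in> bridges L x. l ! m = y} {l \<in> walks L x. l ! m = y \<and> l ! L = x}"
proof (rule bij_betw_byWitness[where f' = butlast])
  have L: "L > 0" using assms by simp
  have fwd: "l @ [x] \<in> walks L x \<and> (l @ [x]) ! m = l ! m \<and> (l @ [x]) ! L = x" if "l \<in> bridges L x" for l
  proof -
    from that have len: "length l = L" and l0: "l ! 0 = x" and a: "\<And>i. i < L \<Longrightarrow> adj (l ! i) (l ! (Suc i mod L))"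
      unfolding bridges_def closed_walks_def by auto
    have "adj ((l @ [x]) ! i) ((l @ [x]) ! Suc i)" if "i < L" for i
      using a[OF that] that len l0 L by (cases "Suc i = L") (auto simp: nth_append)
    then show ?thesis using len l0 assms by (auto simp: walks_iff nth_append)
  qed
  have bwd: "butlast l \<in> bridges L x \<and> butlast l ! m = l ! m \<and> butlast l @ [x] = l"
    if "l \<in> walks L x" "l ! L = x" for l
  proof -
    from that have len: "length l = Suc L" and l0: "l ! 0 = x" and a: "\<And>i. i < L \<Longrightarrow> adj (l ! i) (l ! Suc i)"
      by (auto simp: walks_iff)
    have "last l = x" using that len by (metis diff_Suc_1 last_conv_nth length_0_conv nat.distinct(1))
    moreover have "l \<noteq> []" using len by auto
    ultimately have ap: "butlast l @ [x] = l" using append_butlast_last_id by metis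
    have nb: "butlast l ! i = l ! i" if "i < L" for i using that len by (simp add: nth_butlast)
    have "adj (butlast l ! i) (butlast l ! (Suc i mod L))" if "i < L" for i
    proof (cases "Suc i = L")
      case True
      then show ?thesis using a[OF that] nb[OF that] nb[OF L] l0 \<open>l ! L = x\<close> by simp
    next
      case False
      then show ?thesis using a[OF that] nb that by simp
    qed
    then show ?thesis unfolding bridges_def closed_walks_def using len l0 nb L assms ap by auto
  qed
  show "\<forall>a\<in>{l \<in> bridges L x. l ! m = y}. butlast (a @ [x]) = a" by simp
  show "\<forall>a'\<in>{l \<in> walks L x. l ! m = y \<and> l ! L = x}. butlast a' @ [x] = a'" using bwd by auto
  show "(\<lambda>l. l @ [x]) ` {l \<in> bridges L x. l ! m = y} \<subseteq> {l \<in> walks L x. l ! m = y \<and> l ! L = x}"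
    using fwd by auto
  show "butlast ` {l \<in> walks L x. l ! m = y \<and> l ! L = x} \<subseteq> {l \<in> bridges L x. l ! m = y}"
    using bwd by auto
qed

lemma card_bridges_mid:
  assumes "m < L"
  shows "real (card {l \<in> bridges L x. l ! m = y}) = 6 ^ L * (srw m x y * srw (L - m) y x)"
  using bij_betw_same_card[OF bij_betw_bridges_walks[OF assms, of x y]]
    card_walks_mid[of m "L - m" x y x] assms by simp

lemma bridges_start: "{l \<in> bridges L x. l ! 0 = x} = bridges L x"
  unfolding bridges_def by auto

lemma finite_bridges: "L > 0 \<Longrightarrow> finite (bridges L x)"
  using bij_betw_finite[OF bij_betw_bridges_walks[of 0 L x x]] unfolding bridges_start by simp

lemma card_bridges: "L > 0 \<Longrightarrow> real (card (bridges L x)) = 6 ^ L * srw L x x"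
  using card_bridges_mid[of 0 L x x] unfolding bridges_start by simp

section \<open>Rotations and the mean Green energy of closed walks\<close>

lemma closed_walks_rotate:
  assumes "l \<in> closed_walks L" shows "rotate i l \<in> closed_walks L"
proof -
  have len: "length l = L" and a: "\<And>i. i < L \<Longrightarrow> adj (l ! i) (l ! (Suc i mod L))"
    using assms unfolding closed_walks_def by auto
  have "adj (rotate i l ! j) (rotate i l ! (Suc j mod L))" if "j < L" for j
  proof -
    have L: "L > 0" using that by simp
    then have "rotate i l ! (Suc j mod L) = l ! (Suc ((i + j) mod L) mod L)"
      using len by (simp add: nth_rotate mod_simps)
    moreover have "rotate i l ! j = l ! ((i + j) mod L)" using that len by (simp add: nth_rotate)
    ultimately show ?thesis using a[of "(i + j) mod L"] L by simp
  qed
  then show ?thesis unfolding closed_walks_def using len by simp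
qed

text \<open>In total the list is rotated by a multiple of its length, so the inverse of a rotation
  is again a forward rotation.\<close>

lemma rotate_inverse:
  assumes "l \<noteq> []" shows "rotate ((length l - 1) * i) (rotate i l) = l"
proof -
  obtain m where m: "length l = Suc m" using assms by (cases l) auto
  have "(length l - 1) * i + i = length l * i" unfolding m by simp
  then show ?thesis unfolding rotate_rotate by (simp only: rotate_id mod_mult_self1_is_0)
qed

lemma sum_rotate:
  assumes "finite A" "\<And>l. l \<in> A \<Longrightarrow> l \<noteq> []" "\<And>l i. l \<in> A \<Longrightarrow> rotate i l \<in> A"
  shows "(\<Sum>l\<in>A. F (rotate i l)) = (\<Sum>l\<in>A. F l)"
proof -
  have "inj_on (rotate i) A" by (metis (no_types, lifting) assms(2) inj_onI length_rotate rotate_inverse)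
  moreover have "rotate i ` A = A"
    using assms calculation by (intro endo_inj_surj) auto
  ultimately show ?thesis using sum.reindex[of "rotate i" A F] by (simp add: o_def)
qed

definition energy :: "nat \<Rightarrow> (int ^ 3) list \<Rightarrow> real" where
  "energy K l = (\<Sum>x\<leftarrow>l. \<Sum>y\<leftarrow>l. green K x y)"

lemma sum_list_map_rotate: "sum_list (map f (rotate k l)) = (sum_list (map f l) :: 'b::comm_monoid_add)"
proof -
  let ?m = "k mod length l"
  have "sum_list (map f (rotate k l)) = sum_list (map f (take ?m l)) + sum_list (map f (drop ?m l))"
    by (simp add: rotate_drop_take add.commute)
  also have "\<dots> = sum_list (map f (take ?m l @ drop ?m l))"
    unfolding map_append sum_list_append ..
  finally show ?thesis by simp
qed

lemma energy_rotate: "energy K (rotate k l) = energy K l"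
  unfolding energy_def sum_list_map_rotate ..

lemma sum_list_map_nth: "sum_list (map f l) = (\<Sum>i<length l. f (l ! i))"
  unfolding sum_list_sum_nth by (simp add: atLeast0LessThan)

lemma energy_nonneg: "energy K l \<ge> 0"
  unfolding energy_def sum_list_map_nth by (intro sum_nonneg) auto

text \<open>The walks are grouped by their vertex at time \<open>m\<close>. The finite set
  \<open>Y\<close> of these vertices stays anonymous, since the bounds applied later hold for every
  finite set.\<close>

lemma sum_bridges_value:
  assumes "m < L"
  obtains Y where "finite Y"
    "(\<Sum>l\<in>bridges L x. f (l ! m)) = (\<Sum>y\<in>Y. 6 ^ L * (srw m x y * srw (L - m) y x) * f y)"
proof
  have fin: "finite (bridges L x)" using finite_bridges assms by simp
  show "finite ((\<lambda>l. l ! m) ` bridges L x)" using fin by simp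
  have "(\<Sum>l\<in>bridges L x. f (l ! m)) = (\<Sum>y\<in>(\<lambda>l. l ! m) ` bridges L x. \<Sum>l\<in>{l \<in> bridges L x. l ! m = y}. f (l ! m))"
    by (rule sum.image_gen[OF fin])
  also have "\<dots> = (\<Sum>y\<in>(\<lambda>l. l ! m) ` bridges L x. real (card {l \<in> bridges L x. l ! m = y}) * f y)"
    by (intro sum.cong refl) simp
  finally show "(\<Sum>l\<in>bridges L x. f (l ! m))
      = (\<Sum>y\<in>(\<lambda>l. l ! m) ` bridges L x. 6 ^ L * (srw m x y * srw (L - m) y x) * f y)"
    unfolding card_bridges_mid[OF assms] .
qed

text \<open>The bridge bound leaves one free walk from either end of the time interval, and
  \<open>sum_srw_green_le\<close> applies to each; 432 = 18 * 24.\<close>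

lemma sum_bridges_green_le:
  assumes "m < L"
  shows "(\<Sum>l\<in>bridges L x. green K x (l ! m))
    \<le> 6 ^ L * (432 / pow32 L) * (1 / sqrt (real (Suc m)) + 1 / sqrt (real (Suc (L - m))))"
proof -
  obtain Y where Y: "finite Y"
    "(\<Sum>l\<in>bridges L x. green K x (l ! m)) = (\<Sum>y\<in>Y. 6 ^ L * (srw m x y * srw (L - m) y x) * green K x y)"
    by (rule sum_bridges_value[OF assms, where f = "green K x"])
  have "(\<Sum>y\<in>Y. 6 ^ L * (srw m x y * srw (L - m) y x) * green K x y)
     \<le> (\<Sum>y\<in>Y. 6 ^ L * (18 / pow32 L * (srw m x y + srw (L - m) x y)) * green K x y)"
    using srw_bridge_le[of m L x _ x] assms
    by (intro sum_mono mult_right_mono mult_left_mono) (auto simp: srw_sym[of _ _ x])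
  also have "\<dots> = 6 ^ L * (18 / pow32 L) * ((\<Sum>y\<in>Y. srw m x y * green K x y) + (\<Sum>y\<in>Y. srw (L - m) x y * green K x y))"
  proof -
    have "6 ^ L * (18 / pow32 L * (srw m x y + srw (L - m) x y)) * green K x y
      = 6 ^ L * (18 / pow32 L) * (srw m x y * green K x y + srw (L - m) x y * green K x y)" for y
      by (simp only: mult.assoc distrib_right)
    then show ?thesis by (simp only: sum.distrib sum_distrib_left[symmetric])
  qed
  also have "\<dots> \<le> 6 ^ L * (18 / pow32 L) * (24 / sqrt (real (Suc m)) + 24 / sqrt (real (Suc (L - m))))"
    by (intro mult_left_mono add_mono sum_srw_green_le Y) auto
  also have "\<dots> = 6 ^ L * (432 / pow32 L) * (1 / sqrt (real (Suc m)) + 1 / sqrt (real (Suc (L - m))))"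
  proof -
    have "24 / a + 24 / b = 24 * (1 / a + 1 / b)" for a b :: real by (simp add: distrib_left)
    then show ?thesis by simp
  qed
  finally show ?thesis unfolding Y(2) .
qed

lemma sum_bridges_green_total:
  assumes "L > 0"
  shows "(\<Sum>l\<in>bridges L x. \<Sum>m<L. green K x (l ! m)) \<le> 1728 * 6 ^ L / real L"
proof -
  have "(\<Sum>l\<in>bridges L x. \<Sum>m<L. green K x (l ! m)) = (\<Sum>m<L. \<Sum>l\<in>bridges L x. green K x (l ! m))"
    by (rule sum.swap)
  \<comment> \<open>Passing from \<open>L - m\<close> to \<open>L - Suc m\<close> increases the
    terms and makes the second sum the reversal of the first.\<close>
  also have "\<dots> \<le> (\<Sum>m<L. 6 ^ L * (432 / pow32 L) * (1 / sqrt (real (Suc m)) + 1 / sqrt (real (Suc (L - Suc m)))))"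
  proof (intro sum_mono)
    fix m assume "m \<in> {..<L}"
    then have m: "m < L" by simp
    have "1 / sqrt (real (Suc (L - m))) \<le> 1 / sqrt (real (Suc (L - Suc m)))"
      by (intro divide_left_mono) auto
    then have "6 ^ L * (432 / pow32 L) * (1 / sqrt (real (Suc m)) + 1 / sqrt (real (Suc (L - m))))
       \<le> 6 ^ L * (432 / pow32 L) * (1 / sqrt (real (Suc m)) + 1 / sqrt (real (Suc (L - Suc m))))"
      by (intro mult_left_mono add_left_mono) auto
    then show "(\<Sum>l\<in>bridges L x. green K x (l ! m)) \<le> \<dots>"
      using sum_bridges_green_le[OF m] order_trans by blast
  qed
  also have "\<dots> = 6 ^ L * (432 / pow32 L) * ((\<Sum>m<L. 1 / sqrt (real (Suc m))) + (\<Sum>m<L. 1 / sqrt (real (Suc (L - Suc m)))))"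
    by (simp only: sum.distrib sum_distrib_left[symmetric])
  also have "(\<Sum>m<L. 1 / sqrt (real (Suc (L - Suc m)))) = (\<Sum>m<L. 1 / sqrt (real (Suc m)))"
    using sum.nat_diff_reindex[of "\<lambda>m. 1 / sqrt (real (Suc m))" L] .
  also have "6 ^ L * (432 / pow32 L) * ((\<Sum>m<L. 1 / sqrt (real (Suc m))) + (\<Sum>m<L. 1 / sqrt (real (Suc m))))
     \<le> 6 ^ L * (432 / pow32 L) * (2 * sqrt (real L) + 2 * sqrt (real L))"
    by (intro mult_left_mono add_mono sum_inv_sqrt_le) auto
  also have "\<dots> = 1728 * 6 ^ L / real L"
    unfolding pow32_def using assms by simp
  finally show ?thesis .
qed

text \<open>Closed walks from \<open>x\<close> are permuted when they are restarted at time \<open>i\<close> and translated back to \<open>x\<close>.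
  This reduces the energy to two-point functions.\<close>

definition rebase :: "nat \<Rightarrow> int ^ 3 \<Rightarrow> (int ^ 3) list \<Rightarrow> (int ^ 3) list" where
  "rebase i x l = map (\<lambda>v. v - rotate i l ! 0 + x) (rotate i l)"

lemma closed_walks_translate:
  "l \<in> closed_walks L \<Longrightarrow> map (\<lambda>v. v - c + x) l \<in> closed_walks L"
proof -
  assume a: "l \<in> closed_walks L"
  have "adj (map (\<lambda>v. v - c + x) l ! i) (map (\<lambda>v. v - c + x) l ! (Suc i mod L))" if "i < L" for i
  proof -
    have "length l = L" "Suc i mod L < L" using a that unfolding closed_walks_def by auto
    then show ?thesis using a that unfolding closed_walks_def adj_def by simp
  qed
  then show ?thesis using a unfolding closed_walks_def by simp
qed

lemma rebase_bridges:
  assumes "L > 0" "l \<in> bridges L x" shows "rebase i x l \<in> bridges L x"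
proof -
  have "rebase i x l \<in> closed_walks L"
    unfolding rebase_def using assms by (intro closed_walks_translate closed_walks_rotate) (simp add: bridges_def)
  moreover have "rebase i x l ! 0 = x"
    unfolding rebase_def using assms by (subst nth_map) (auto simp: bridges_def closed_walks_def)
  ultimately show ?thesis by (simp add: bridges_def)
qed

lemma inj_rebase: "L > 0 \<Longrightarrow> inj_on (rebase i x) (bridges L x)"
proof (rule inj_on_inverseI[where g = "rebase ((L - 1) * i) x"])
  fix l assume L: "L > 0" and l: "l \<in> bridges L x"
  then have len: "length l = L" "l \<noteq> []" "l ! 0 = x" unfolding bridges_def closed_walks_def by auto
  define g where "g = (\<lambda>v. v - rotate i l ! 0 + x)"
  have "rotate ((L - 1) * i) (rebase i x l) = map g l"
    unfolding rebase_def g_def[symmetric] rotate_map using rotate_inverse[of l i] len by simp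
  then have "rebase ((L - 1) * i) x (rebase i x l) = map (\<lambda>v. v - g x + x) (map g l)"
    unfolding rebase_def[of "(L - 1) * i"] using len L by simp
  also have "\<dots> = l" unfolding g_def by (simp add: o_def)
  finally show "rebase ((L - 1) * i) x (rebase i x l) = l" .
qed

lemma sum_bridges_rebase:
  assumes "L > 0"
  shows "(\<Sum>l\<in>bridges L x. F (rebase i x l)) = (\<Sum>l\<in>bridges L x. F l)"
proof -
  have "rebase i x ` bridges L x = bridges L x"
    using assms finite_bridges inj_rebase rebase_bridges by (intro endo_inj_surj) auto
  then show ?thesis using sum.reindex[OF inj_rebase[OF assms, of i x], of F] by (simp add: o_def)
qed

text \<open>Each of the \<open>L\<close> base points contributes at most
  \<open>1728 * 6 ^ L / L\<close> after rebasing. For even \<open>L\<close> there are at least of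
  order \<open>6 ^ L / L^(3/2)\<close> bridges, so their mean energy is at most of order
  \<open>L^(3/2)\<close>.\<close>

lemma sum_bridges_energy:
  assumes "L > 0"
  shows "(\<Sum>l\<in>bridges L x. energy K l) \<le> 1728 * 6 ^ L"
proof -
  have e: "(\<Sum>j<L. green K (l ! i) (l ! j)) = (\<Sum>m<L. green K x (rebase i x l ! m))"
    if "l \<in> bridges L x" "i < L" for l i
  proof -
    have len: "length l = L" using that unfolding bridges_def closed_walks_def by auto
    have r0: "rotate i l ! 0 = l ! i" using len that assms by (simp add: nth_rotate)
    have "(\<Sum>m<L. green K x (rebase i x l ! m)) = (\<Sum>m<L. green K (l ! i) (rotate i l ! m))"
    proof (intro sum.cong refl)
      fix m assume "m \<in> {..<L}"
      then have "rebase i x l ! m = rotate i l ! m - l ! i + x"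
        unfolding rebase_def r0 using len by simp
      then show "green K x (rebase i x l ! m) = green K (l ! i) (rotate i l ! m)"
        using green_translate[of K "l ! i" "x - l ! i" "rotate i l ! m"] by (simp add: diff_add_eq add_diff_eq)
    qed
    also have "\<dots> = (\<Sum>y\<leftarrow>rotate i l. green K (l ! i) y)" using len by (simp add: sum_list_map_nth)
    also have "\<dots> = (\<Sum>j<L. green K (l ! i) (l ! j))"
      unfolding sum_list_map_rotate using len by (simp add: sum_list_map_nth)
    finally show ?thesis by simp
  qed
  have "(\<Sum>l\<in>bridges L x. energy K l) = (\<Sum>l\<in>bridges L x. \<Sum>i<L. \<Sum>j<L. green K (l ! i) (l ! j))"
    by (intro sum.cong refl) (auto simp: energy_def sum_list_map_nth bridges_def closed_walks_def)
  also have "\<dots> = (\<Sum>i<L. \<Sum>l\<in>bridges L x. \<Sum>j<L. green K (l ! i) (l ! j))"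
    by (rule sum.swap)
  also have "\<dots> = (\<Sum>i<L. \<Sum>l\<in>bridges L x. \<Sum>m<L. green K x (rebase i x l ! m))"
    by (rule sum.cong[OF refl], rule sum.cong[OF refl], rule e) auto
  also have "\<dots> = (\<Sum>i<L. \<Sum>l\<in>bridges L x. \<Sum>m<L. green K x (l ! m))"
    by (intro sum.cong refl sum_bridges_rebase[OF assms, where F = "\<lambda>l. \<Sum>m<L. green K x (l ! m)"])
  also have "\<dots> \<le> (\<Sum>i<L. 1728 * 6 ^ L / real L)"
    by (intro sum_mono sum_bridges_green_total assms)
  finally show ?thesis using assms by simp
qed

text \<open>\<open>2239488 = 4 * 324 * 1728\<close>: by Markov's inequality at most a quarter of the lower bound
  \<open>srw_return_even_lower\<close> for the closed walks from a point fails this.\<close>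

definition low_energy :: "nat \<Rightarrow> (int ^ 3) list \<Rightarrow> bool" where
  "low_energy K l \<longleftrightarrow> energy K l \<le> 2239488 * pow32 (length l)"

lemma card_high_energy:
  assumes "L > 0"
  shows "real (card {l \<in> bridges L x. \<not> low_energy K l}) \<le> 6 ^ L / (1296 * pow32 L)"
proof -
  have fin: "finite (bridges L x)" using finite_bridges assms by simp
  have p: "pow32 L > 0" using assms by simp
  have "real (card {l \<in> bridges L x. \<not> low_energy K l}) * (2239488 * pow32 L)
     = (\<Sum>l\<in>{l \<in> bridges L x. \<not> low_energy K l}. 2239488 * pow32 L)" by simp
  also have "\<dots> \<le> (\<Sum>l\<in>{l \<in> bridges L x. \<not> low_energy K l}. energy K l)"
    by (intro sum_mono) (auto simp: low_energy_def bridges_def closed_walks_def)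
  also have "\<dots> \<le> (\<Sum>l\<in>bridges L x. energy K l)"
    by (intro sum_mono2 fin) (auto intro: energy_nonneg)
  also have "\<dots> \<le> 1728 * 6 ^ L" by (rule sum_bridges_energy[OF assms])
  finally show ?thesis using p by (simp add: field_simps)
qed

section \<open>Closed walks that stay in a box\<close>

text \<open>The midpoint of a confined bridge is one of at most \<open>27 n^3\<close> points of the
  box, and \<open>srw_upper\<close> bounds both legs. Passing from half to full length costs a
  factor 8, and the 216 comes from \<open>216 ^ 3 = 27 * 36 * 8 * 1296\<close>.\<close>

lemma card_confined:
  assumes "even L" "L > 0" "n > 0" "sqrt (real L) \<ge> 216 * real n"
  shows "real (card {l \<in> bridges L x. set l \<subseteq> lattice_box 0 n}) \<le> 6 ^ L / (1296 * pow32 L)"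
proof -
  obtain h where h: "L = 2 * h" "h > 0" using assms by auto
  let ?B = "lattice_box 0 n :: (int ^ 3) set"
  have fin: "finite (bridges L x)" using finite_bridges assms by simp
  have "{l \<in> bridges L x. set l \<subseteq> ?B} \<subseteq> (\<Union>y\<in>?B. {l \<in> bridges L x. l ! h = y})"
  proof
    fix l assume l: "l \<in> {l \<in> bridges L x. set l \<subseteq> ?B}"
    then have "l ! h \<in> set l" using h by (intro nth_mem) (auto simp: bridges_def closed_walks_def)
    then show "l \<in> (\<Union>y\<in>?B. {l \<in> bridges L x. l ! h = y})" using l by auto
  qed
  then have "card {l \<in> bridges L x. set l \<subseteq> ?B} \<le> card (\<Union>y\<in>?B. {l \<in> bridges L x. l ! h = y})"
    using fin finite_lattice_box by (intro card_mono) auto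
  also have "\<dots> \<le> (\<Sum>y\<in>?B. card {l \<in> bridges L x. l ! h = y})"
    by (rule card_UN_le[OF finite_lattice_box])
  finally have "real (card {l \<in> bridges L x. set l \<subseteq> ?B}) \<le> (\<Sum>y\<in>?B. real (card {l \<in> bridges L x. l ! h = y}))"
    by (simp only: of_nat_sum[symmetric] of_nat_le_iff)
  also have "\<dots> \<le> (\<Sum>y\<in>?B. 6 ^ L * (6 / pow32 (Suc h) * (6 / pow32 (Suc h))))"
  proof (intro sum_mono)
    fix y
    have "L - h = h" "h < L" using h by auto
    then show "real (card {l \<in> bridges L x. l ! h = y}) \<le> 6 ^ L * (6 / pow32 (Suc h) * (6 / pow32 (Suc h)))"
      unfolding card_bridges_mid[OF \<open>h < L\<close>] \<open>L - h = h\<close> by (intro mult_left_mono mult_mono srw_upper) auto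
  qed
  also have "\<dots> = real (card ?B) * (6 ^ L * (6 / pow32 (Suc h) * (6 / pow32 (Suc h))))" by simp
  also have "\<dots> \<le> 27 * real n ^ 3 * (6 ^ L * (6 / pow32 (Suc h) * (6 / pow32 (Suc h))))"
  proof (rule mult_right_mono)
    have "real (card ?B) \<le> real ((2 * n + 1) ^ 3)" using card_lattice_box of_nat_le_iff by blast
    also have "\<dots> = (2 * real n + 1) ^ 3" by (simp only: of_nat_power of_nat_add of_nat_mult of_nat_numeral of_nat_1)
    also have "\<dots> \<le> (3 * real n) ^ 3" using assms(3) by (intro power_mono) auto
    finally show "real (card ?B) \<le> 27 * real n ^ 3" by (simp add: power_mult_distrib)
  qed simp
  also have "\<dots> \<le> 6 ^ L / (1296 * pow32 L)"
  proof -
    have q: "pow32 (Suc h) * pow32 (Suc h) \<ge> pow32 L * pow32 L / 8"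
    proof -
      have sq: "pow32 m * pow32 m = real m ^ 3" for m
      proof -
        have "pow32 m * pow32 m = real m * real m * (sqrt (real m) * sqrt (real m))"
          unfolding pow32_def by (simp only: mult_ac)
        then show ?thesis by (simp add: power3_eq_cube)
      qed
      have "real L ^ 3 \<le> (2 * real (Suc h)) ^ 3" unfolding h by (intro power_mono) auto
      then show ?thesis unfolding sq by (simp add: power_mult_distrib del: of_nat_Suc)
    qed
    have s: "216 ^ 3 * real n ^ 3 \<le> pow32 L"
    proof -
      have "(216 * real n) ^ 3 \<le> sqrt (real L) ^ 3" using assms by (intro power_mono) auto
      also have "\<dots> = pow32 L" unfolding pow32_def by (simp add: power3_eq_cube)
      finally show ?thesis by (simp add: power_mult_distrib)
    qed
    have P: "pow32 L > 0" "pow32 (Suc h) > 0" using assms by auto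
    have "27 * real n ^ 3 * (6 ^ L * (6 / pow32 (Suc h) * (6 / pow32 (Suc h))))
      = 6 ^ L * (972 * real n ^ 3) / (pow32 (Suc h) * pow32 (Suc h))" by simp
    also have "\<dots> \<le> 6 ^ L * (972 * real n ^ 3) / (pow32 L * pow32 L / 8)"
      using q P by (intro divide_left_mono) auto
    also have "\<dots> = 6 ^ L * (1296 * (7776 * real n ^ 3)) / (1296 * (pow32 L * pow32 L))" by simp
    also have "\<dots> \<le> 6 ^ L * pow32 L / (1296 * (pow32 L * pow32 L))"
      using s P by (intro divide_right_mono mult_left_mono) auto
    also have "\<dots> = 6 ^ L / (1296 * pow32 L)" using P by simp
    finally show ?thesis .
  qed
  finally show ?thesis .
qed

section \<open>Closed walks through a given set\<close>

text \<open>The number of walks that meet \<open>\<kappa>\<close> is bounded below by the second moment method applied to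
  \<open>hits\<close>. By invariance under rotation, one of the hits may be placed at time 0.\<close>

definition touching_walks :: "nat \<Rightarrow> ((int ^ 3) list \<Rightarrow> bool) \<Rightarrow> (int ^ 3) list \<Rightarrow> (int ^ 3) list set" where
  "touching_walks L R \<kappa> = {l \<in> closed_walks L. R l \<and> set l \<inter> set \<kappa> \<noteq> {}}"

definition hits :: "(int ^ 3) list \<Rightarrow> (int ^ 3) list \<Rightarrow> real" where
  "hits \<kappa> l = (\<Sum>v\<leftarrow>l. \<Sum>x\<leftarrow>\<kappa>. of_bool (v = x))"

lemma hits_rotate: "hits \<kappa> (rotate i l) = hits \<kappa> l"
  unfolding hits_def sum_list_map_rotate ..

lemma finite_touching_walks:
  assumes "L > 0" shows "finite (touching_walks L R \<kappa>)"
proof -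
  have "touching_walks L R \<kappa> \<subseteq> (\<Union>x\<in>set \<kappa>. \<Union>i<L. rotate ((L - 1) * i) ` bridges L x)"
  proof
    fix l assume "l \<in> touching_walks L R \<kappa>"
    then have l: "l \<in> closed_walks L" "length l = L" and "set l \<inter> set \<kappa> \<noteq> {}"
      unfolding touching_walks_def closed_walks_def by auto
    then obtain v where "v \<in> set l" "v \<in> set \<kappa>" by blast
    then obtain i where i: "i < L" "l ! i \<in> set \<kappa>" using l(2) by (metis in_set_conv_nth)
    have "rotate i l \<in> bridges L (l ! i)"
      unfolding bridges_def using closed_walks_rotate[OF l(1)] l i by (simp add: nth_rotate)
    moreover have "l = rotate ((L - 1) * i) (rotate i l)" using rotate_inverse[of l i] l assms by auto
    ultimately show "l \<in> (\<Union>x\<in>set \<kappa>. \<Union>i<L. rotate ((L - 1) * i) ` bridges L x)" using i by blast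
  qed
  moreover have "finite (\<Union>x\<in>set \<kappa>. \<Union>i<L. rotate ((L - 1) * i) ` bridges L x)"
    using finite_bridges[OF assms] by auto
  ultimately show ?thesis by (rule finite_subset)
qed

lemma sum_touching_nth:
  assumes "L > 0" "\<And>l i. R (rotate i l) = R l" "i < L" "\<And>l. F (rotate i l) = F l"
  shows "(\<Sum>l\<in>touching_walks L R \<kappa>. f (l ! i) * F l) = (\<Sum>l\<in>touching_walks L R \<kappa>. f (l ! 0) * (F l :: real))"
proof -
  have len: "l \<noteq> [] \<and> length l = L" if "l \<in> touching_walks L R \<kappa>" for l
    using that assms(1) unfolding touching_walks_def closed_walks_def by auto
  have "(\<Sum>l\<in>touching_walks L R \<kappa>. f (l ! i) * F l)
      = (\<Sum>l\<in>touching_walks L R \<kappa>. f (rotate i l ! 0) * F (rotate i l))"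
    using len assms by (intro sum.cong refl) (simp add: nth_rotate)
  also have "\<dots> = (\<Sum>l\<in>touching_walks L R \<kappa>. f (l ! 0) * F l)"
    by (rule sum_rotate[where F = "\<lambda>l. f (l ! 0) * F l"])
      (use finite_touching_walks assms len in \<open>auto simp: touching_walks_def closed_walks_rotate\<close>)
  finally show ?thesis .
qed

text \<open>Every hit is rotated to time 0, where the walk becomes a bridge from a point of
  \<open>\<kappa>\<close>; the \<open>L\<close> times give the factor. The first moment is the case
  \<open>F = 1\<close>, the second the case \<open>F = hits \<kappa>\<close>.\<close>

lemma sum_hits:
  assumes "L > 0" "\<And>l i. R (rotate i l) = R l" "\<And>l i. F (rotate i l) = F l"
  shows "(\<Sum>l\<in>touching_walks L R \<kappa>. hits \<kappa> l * F l) = real L * (\<Sum>x\<leftarrow>\<kappa>. \<Sum>l\<in>{l \<in> bridges L x. R l}. F l)"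
proof -
  let ?A = "touching_walks L R \<kappa>"
  let ?f = "\<lambda>v. \<Sum>x\<leftarrow>\<kappa>. of_bool (v = x) :: real"
  have "(\<Sum>l\<in>?A. hits \<kappa> l * F l) = (\<Sum>l\<in>?A. \<Sum>i<L. ?f (l ! i) * F l)"
    unfolding hits_def sum_list_map_nth[of ?f] sum_distrib_right
    by (intro sum.cong) (auto simp: touching_walks_def closed_walks_def)
  also have "\<dots> = (\<Sum>i<L. \<Sum>l\<in>?A. ?f (l ! i) * F l)" by (rule sum.swap)
  also have "\<dots> = (\<Sum>i<L. \<Sum>l\<in>?A. ?f (l ! 0) * F l)"
    using assms by (intro sum.cong refl sum_touching_nth) auto
  also have "\<dots> = real L * (\<Sum>l\<in>?A. ?f (l ! 0) * F l)" by simp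
  also have "(\<Sum>l\<in>?A. ?f (l ! 0) * F l) = (\<Sum>j<length \<kappa>. \<Sum>l\<in>?A. of_bool (l ! 0 = \<kappa> ! j) * F l)"
    unfolding sum_list_map_nth[of _ \<kappa>] sum_distrib_right by (rule sum.swap)
  also have "\<dots> = (\<Sum>j<length \<kappa>. \<Sum>l\<in>{l \<in> bridges L (\<kappa> ! j). R l}. F l)"
  proof (rule sum.cong[OF refl])
    fix j assume "j \<in> {..<length \<kappa>}"
    then have j: "\<kappa> ! j \<in> set \<kappa>" by simp
    have e: "{l \<in> ?A. l ! 0 = \<kappa> ! j} = {l \<in> bridges L (\<kappa> ! j). R l}"
    proof -
      have "l ! 0 \<in> set l" if "l \<in> closed_walks L" for l
        using that assms(1) unfolding closed_walks_def by (intro nth_mem) auto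
      then show ?thesis unfolding touching_walks_def bridges_def using j by force
    qed
    have "(\<Sum>l\<in>?A. of_bool (l ! 0 = \<kappa> ! j) * F l) = (\<Sum>l\<in>?A. if l ! 0 = \<kappa> ! j then F l else 0)"
      by (intro sum.cong) auto
    also have "\<dots> = (\<Sum>l\<in>{l \<in> ?A. l ! 0 = \<kappa> ! j}. F l)"
      by (rule sum.inter_filter[symmetric, OF finite_touching_walks[OF assms(1)]])
    finally show "(\<Sum>l\<in>?A. of_bool (l ! 0 = \<kappa> ! j) * F l) = (\<Sum>l\<in>{l \<in> bridges L (\<kappa> ! j). R l}. F l)"
      unfolding e .
  qed
  also have "\<dots> = (\<Sum>x\<leftarrow>\<kappa>. \<Sum>l\<in>{l \<in> bridges L x. R l}. F l)"
    by (simp only: sum_list_map_nth)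
  finally show ?thesis .
qed

lemma sum_bridges_hits_le:
  assumes "L > 0" "K > L"
  shows "(\<Sum>l\<in>bridges L x. hits \<kappa> l) \<le> 6 ^ L * (36 / pow32 L) * (\<Sum>y\<leftarrow>\<kappa>. green K x y)"
proof -
  have fin: "finite (bridges L x)" using finite_bridges assms by simp
  have "(\<Sum>l\<in>bridges L x. hits \<kappa> l) = (\<Sum>l\<in>bridges L x. \<Sum>i<L. \<Sum>j<length \<kappa>. of_bool (l ! i = \<kappa> ! j))"
    unfolding hits_def sum_list_map_nth by (intro sum.cong) (auto simp: bridges_def closed_walks_def)
  also have "\<dots> = (\<Sum>i<L. \<Sum>l\<in>bridges L x. \<Sum>j<length \<kappa>. of_bool (l ! i = \<kappa> ! j))" by (rule sum.swap)
  also have "\<dots> = (\<Sum>i<L. \<Sum>j<length \<kappa>. \<Sum>l\<in>bridges L x. of_bool (l ! i = \<kappa> ! j))"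
    by (rule sum.cong[OF refl], rule sum.swap)
  also have "\<dots> = (\<Sum>j<length \<kappa>. \<Sum>i<L. \<Sum>l\<in>bridges L x. of_bool (l ! i = \<kappa> ! j))" by (rule sum.swap)
  also have "\<dots> = (\<Sum>j<length \<kappa>. \<Sum>i<L. 6 ^ L * (srw i x (\<kappa> ! j) * srw (L - i) (\<kappa> ! j) x))"
  proof (intro sum.cong refl)
    fix i j assume "i \<in> {..<L}"
    then have "i < L" by simp
    have "(\<Sum>l\<in>bridges L x. of_bool (l ! i = \<kappa> ! j)) = real (card {l \<in> bridges L x. l ! i = \<kappa> ! j})"
      using fin by (simp add: of_bool_def flip: sum.inter_filter)
    then show "(\<Sum>l\<in>bridges L x. of_bool (l ! i = \<kappa> ! j)) = 6 ^ L * (srw i x (\<kappa> ! j) * srw (L - i) (\<kappa> ! j) x)"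
      unfolding card_bridges_mid[OF \<open>i < L\<close>] .
  qed
  also have "\<dots> \<le> (\<Sum>j<length \<kappa>. 6 ^ L * (36 / pow32 L * green K x (\<kappa> ! j)))"
  proof (rule sum_mono)
    fix j
    have "(\<Sum>i<L. 6 ^ L * (srw i x (\<kappa> ! j) * srw (L - i) (\<kappa> ! j) x)) = 6 ^ L * (\<Sum>i<L. srw i x (\<kappa> ! j) * srw (L - i) (\<kappa> ! j) x)"
      by (rule sum_distrib_left[symmetric])
    also have "\<dots> \<le> 6 ^ L * (36 / pow32 L * green K x (\<kappa> ! j))"
      by (intro mult_left_mono sum_bridge_le_green assms) auto
    finally show "(\<Sum>i<L. 6 ^ L * (srw i x (\<kappa> ! j) * srw (L - i) (\<kappa> ! j) x)) \<le> 6 ^ L * (36 / pow32 L * green K x (\<kappa> ! j))" .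
  qed
  also have "\<dots> = 6 ^ L * (36 / pow32 L) * (\<Sum>y\<leftarrow>\<kappa>. green K x y)"
    unfolding sum_list_map_nth sum_distrib_left by (simp only: mult.assoc)
  finally show ?thesis .
qed

text \<open>The share 1/648 of good bridges enters squared through Cauchy-Schwarz; 36 comes from
  \<open>sum_bridge_le_green\<close> and 2239488 from \<open>low_energy\<close>.\<close>

definition touch_const :: real where "touch_const = 1 / (648\<^sup>2 * 36 * 2239488)"

lemma touch_const_pos: "touch_const > 0" unfolding touch_const_def by simp

text \<open>With \<open>n = length \<kappa>\<close> and \<open>p = pow32 L\<close>, the first moment
  of \<open>hits\<close> is at least of order \<open>L * n * 6 ^ L / p\<close>, and low energy keeps
  the second at most of order \<open>L * n^(3/2) * 6 ^ L / p\<close>. Squaring the first and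
  dividing by the second leaves \<open>sqrt n\<close>.\<close>

lemma card_touching_walks:
  assumes "L > 0" "K > L" "even L" "\<And>l i. R (rotate i l) = R l"
    and bad: "\<And>x. real (card {l \<in> bridges L x. \<not> R l}) \<le> 6 ^ L / (648 * pow32 L)"
    and \<kappa>: "\<kappa> \<noteq> []" "low_energy K \<kappa>"
  shows "real (card (touching_walks L R \<kappa>)) \<ge> touch_const * real L * 6 ^ L * sqrt (real (length \<kappa>)) / pow32 L"
proof -
  let ?A = "touching_walks L R \<kappa>"
  define n where "n = real (length \<kappa>)"
  define p where "p = pow32 L"
  define W :: real where "W = 6 ^ L"
  have n: "n > 0" and p: "p > 0" and W: "W > 0" using \<kappa> assms(1) unfolding n_def p_def W_def by auto
  have fin: "finite ?A" using finite_touching_walks assms(1) by blast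
  have good: "real (card {l \<in> bridges L x. R l}) \<ge> W / (648 * p)" for x
  proof -
    have fb: "finite (bridges L x)" using finite_bridges assms(1) by simp
    have "bridges L x = {l \<in> bridges L x. R l} \<union> {l \<in> bridges L x. \<not> R l}" by auto
    then have "card (bridges L x) = card {l \<in> bridges L x. R l} + card {l \<in> bridges L x. \<not> R l}"
      using fb card_Un_disjoint[of "{l \<in> bridges L x. R l}" "{l \<in> bridges L x. \<not> R l}"] by auto
    then have "real (card {l \<in> bridges L x. R l}) = real (card (bridges L x)) - real (card {l \<in> bridges L x. \<not> R l})"
      by simp
    \<comment> \<open>The bad bridges are at most half of the lower bound for all bridges: 1/324 -
      1/648 = 1/648.\<close>
    also have "\<dots> \<ge> W * (1 / (324 * p)) - W / (648 * p)"
      unfolding card_bridges[OF assms(1)] W_def p_def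
      by (intro diff_mono mult_left_mono srw_return_even_lower bad assms(1,3)) auto
    also have "W * (1 / (324 * p)) - W / (648 * p) = W / (648 * p)" using p by (simp add: field_simps)
    finally show ?thesis .
  qed
  have "(\<Sum>l\<in>?A. hits \<kappa> l) = real L * (\<Sum>x\<leftarrow>\<kappa>. real (card {l \<in> bridges L x. R l}))"
    using sum_hits[OF assms(1), of R "\<lambda>_. 1" \<kappa>] assms(4) by simp
  also have "\<dots> \<ge> real L * (\<Sum>x\<leftarrow>\<kappa>. W / (648 * p))"
    by (intro mult_left_mono sum_list_mono good) auto
  also have "real L * (\<Sum>x\<leftarrow>\<kappa>. W / (648 * p)) = real L * (n * (W / (648 * p)))"
    by (simp add: sum_list_triv n_def)
  finally have first: "(\<Sum>l\<in>?A. hits \<kappa> l) \<ge> real L * (n * (W / (648 * p)))" .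
  have "(\<Sum>l\<in>?A. hits \<kappa> l * hits \<kappa> l) = real L * (\<Sum>x\<leftarrow>\<kappa>. \<Sum>l\<in>{l \<in> bridges L x. R l}. hits \<kappa> l)"
    using assms(4) by (intro sum_hits[OF assms(1)]) (auto simp: hits_rotate)
  also have "\<dots> \<le> real L * (\<Sum>x\<leftarrow>\<kappa>. W * (36 / p) * (\<Sum>y\<leftarrow>\<kappa>. green K x y))"
  proof (intro mult_left_mono sum_list_mono)
    fix x
    have "hits \<kappa> l \<ge> 0" for l unfolding hits_def sum_list_map_nth by (intro sum_nonneg) auto
    then have "(\<Sum>l\<in>{l \<in> bridges L x. R l}. hits \<kappa> l) \<le> (\<Sum>l\<in>bridges L x. hits \<kappa> l)"
      using finite_bridges assms(1) by (intro sum_mono2) auto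
    also have "\<dots> \<le> W * (36 / p) * (\<Sum>y\<leftarrow>\<kappa>. green K x y)"
      unfolding W_def p_def by (rule sum_bridges_hits_le[OF assms(1,2)])
    finally show "(\<Sum>l\<in>{l \<in> bridges L x. R l}. hits \<kappa> l) \<le> W * (36 / p) * (\<Sum>y\<leftarrow>\<kappa>. green K x y)" .
  qed simp
  also have "\<dots> = real L * (W * (36 / p) * energy K \<kappa>)"
    unfolding energy_def sum_list_const_mult ..
  also have "\<dots> \<le> real L * (W * (36 / p) * (2239488 * (n * sqrt n)))"
    using \<kappa>(2) W p unfolding low_energy_def pow32_def n_def by (intro mult_left_mono) auto
  finally have second: "(\<Sum>l\<in>?A. (hits \<kappa> l)\<^sup>2) \<le> real L * (W * (36 / p) * (2239488 * (n * sqrt n)))"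
    by (simp add: power2_eq_square)
  have "(real L * (n * (W / (648 * p))))\<^sup>2 \<le> (\<Sum>l\<in>?A. hits \<kappa> l * 1)\<^sup>2"
    using first n p W by (intro power_mono) auto
  also have "\<dots> \<le> (\<Sum>l\<in>?A. (hits \<kappa> l)\<^sup>2) * (\<Sum>l\<in>?A. 1\<^sup>2)"
    by (rule Cauchy_Schwarz_ineq_sum)
  also have "\<dots> \<le> real L * (W * (36 / p) * (2239488 * (n * sqrt n))) * real (card ?A)"
    using mult_right_mono[OF second, of "\<Sum>l\<in>?A. 1\<^sup>2"] by simp
  finally have main: "(real L * (n * (W / (648 * p))))\<^sup>2 \<le> real L * (W * (36 / p) * (2239488 * (n * sqrt n))) * real (card ?A)" .
  define D where "D = real L * (W * (36 / p) * (2239488 * (n * sqrt n)))"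
  have D: "D > 0" unfolding D_def using n p W assms(1) by simp
  have "touch_const * real L * W * sqrt n / p * D = (real L * (n * (W / (648 * p))))\<^sup>2"
  proof -
    have "sqrt n * sqrt n = n" using n by simp
    then have "touch_const * real L * W * sqrt n / p * D = touch_const * real L * W / p * (real L * (W * (36 / p) * (2239488 * (n * n))))"
      unfolding D_def by (simp add: mult_ac)
    also have "\<dots> = (real L * (n * (W / (648 * p))))\<^sup>2"
      unfolding touch_const_def power2_eq_square using p by (simp add: field_simps)
    finally show ?thesis .
  qed
  then have "touch_const * real L * W * sqrt n / p * D \<le> real (card ?A) * D"
    using main unfolding D_def by (simp only: mult.commute)
  then have "touch_const * real L * W * sqrt n / p \<le> real (card ?A)" using D by (rule mult_right_le_imp_le)
  then show ?thesis unfolding W_def p_def n_def .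
qed

section \<open>Exploring a Poisson point process\<close>

context
  fixes \<Lambda> :: "'a measure" and P :: "'a measure measure"
  assumes ppp: "poisson_point_process \<Lambda> P"
begin

lemmas pppD = ppp[unfolded poisson_point_process_def]

lemmas ppp_prob_space = pppD[THEN conjunct1]
  and ppp_counts = pppD[THEN conjunct2, THEN conjunct1]
  and ppp_measurable_all = pppD[THEN conjunct2, THEN conjunct2, THEN conjunct1]
  and ppp_law = pppD[THEN conjunct2, THEN conjunct2, THEN conjunct2, THEN conjunct1]
  and ppp_indep = pppD[THEN conjunct2, THEN conjunct2, THEN conjunct2, THEN conjunct2, THEN conjunct2]

lemma ppp_sets: "\<eta> \<in> space P \<Longrightarrow> sets \<eta> = sets \<Lambda>"
  using ppp_counts by simp

lemma ppp_measurable: "A \<in> sets \<Lambda> \<Longrightarrow> (\<lambda>\<eta>. emeasure \<eta> A) \<in> borel_measurable P"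
  using ppp_measurable_all by simp

lemma ppp_present_iff:
  assumes "\<eta> \<in> space P" "A \<in> sets \<Lambda>"
  shows "emeasure \<eta> A \<ge> 1 \<longleftrightarrow> emeasure \<eta> A \<noteq> 0"
proof -
  have "emeasure \<eta> A = \<infinity> \<or> (\<exists>k::nat. emeasure \<eta> A = of_nat k)"
    using ppp_counts assms by simp
  then show ?thesis
  proof
    assume "\<exists>k::nat. emeasure \<eta> A = of_nat k"
    then obtain k :: nat where k: "emeasure \<eta> A = of_nat k" by blast
    show ?thesis unfolding k by (cases k) auto
  qed simp
qed

lemma ppp_prob_absent:
  assumes "A \<in> sets \<Lambda>" "emeasure \<Lambda> A < \<infinity>"
  shows "measure P {\<eta> \<in> space P. \<not> emeasure \<eta> A \<ge> 1} = exp (- measure \<Lambda> A)"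
proof -
  have "{\<eta> \<in> space P. \<not> emeasure \<eta> A \<ge> 1} = {\<eta> \<in> space P. emeasure \<eta> A = of_nat 0}"
    using ppp_present_iff assms by auto
  also have "measure P \<dots> = exp (- measure \<Lambda> A) * measure \<Lambda> A ^ 0 / fact 0"
    using ppp_law[rule_format, OF assms, of 0] .
  finally show ?thesis by simp
qed

lemma ppp_prob_present:
  assumes "A \<in> sets \<Lambda>" "emeasure \<Lambda> A < \<infinity>"
  shows "measure P {\<eta> \<in> space P. emeasure \<eta> A \<ge> 1} = 1 - exp (- measure \<Lambda> A)"
proof -
  interpret prob_space P by (rule ppp_prob_space)
  have "{\<eta> \<in> space P. \<not> emeasure \<eta> A \<ge> 1} \<in> events" using ppp_measurable[OF assms(1)] by measurable
  then have "prob (space P - {\<eta> \<in> space P. \<not> emeasure \<eta> A \<ge> 1}) = 1 - exp (- measure \<Lambda> A)"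
    using prob_compl ppp_prob_absent[OF assms] by simp
  moreover have "space P - {\<eta> \<in> space P. \<not> emeasure \<eta> A \<ge> 1} = {\<eta> \<in> space P. emeasure \<eta> A \<ge> 1}" by auto
  ultimately show ?thesis by simp
qed

lemma ppp_prob_pattern:
  assumes fin: "finite A" "finite B" "A \<inter> B = {}"
    and c: "\<And>c. c \<in> A \<union> B \<Longrightarrow> {c} \<in> sets \<Lambda>" "\<And>c. c \<in> A \<union> B \<Longrightarrow> emeasure \<Lambda> {c} < \<infinity>"
  shows "measure P {\<eta> \<in> space P. (\<forall>c\<in>A. emeasure \<eta> {c} \<ge> 1) \<and> (\<forall>c\<in>B. \<not> emeasure \<eta> {c} \<ge> 1)}
     = (\<Prod>c\<in>A. 1 - exp (- measure \<Lambda> {c})) * (\<Prod>c\<in>B. exp (- measure \<Lambda> {c}))"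
proof -
  interpret prob_space P by (rule ppp_prob_space)
  show ?thesis
  proof (cases "A \<union> B = {}")
    case True
    then have "A = {}" "B = {}" by auto
    then show ?thesis by (simp add: prob_space)
  next
    case False
    \<comment> \<open>Independence is available for families indexed by natural numbers, hence the
      enumeration.\<close>
    obtain f where f: "bij_betw f {0..<card (A \<union> B)} (A \<union> B)"
      using ex_bij_betw_nat_finite fin by blast
    define I where "I = {0..<card (A \<union> B)}"
    define S where "S i = (if f i \<in> A then {1..} else - {1..} :: ennreal set)" for i
    have fI: "f ` I = A \<union> B" "inj_on f I" using f unfolding I_def bij_betw_def by auto
    have ind: "indep_vars (\<lambda>_. borel) (\<lambda>i \<eta>. emeasure \<eta> {f i}) I"
    proof -
      have "disjoint_family_on (\<lambda>i. {f i}) I"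
        using fI(2) unfolding disjoint_family_on_def inj_on_def by auto
      moreover have "(\<lambda>i. {f i}) ` I \<subseteq> sets \<Lambda>" using fI(1) c(1) by auto
      ultimately show ?thesis
        using ppp_indep[rule_format, of I "\<lambda>i. {f i}"] by (simp add: I_def)
    qed
    define E where "E c = {\<eta> \<in> space P. if c \<in> A then emeasure \<eta> {c} \<ge> 1 else \<not> emeasure \<eta> {c} \<ge> 1}" for c
    have pre: "(\<lambda>\<eta>. emeasure \<eta> {f i}) -` S i \<inter> space P = E (f i)" for i
      unfolding S_def E_def by auto
    have ne: "I \<noteq> {}" using fI(1) False by auto
    have "prob (\<Inter>i\<in>I. (\<lambda>\<eta>. emeasure \<eta> {f i}) -` S i \<inter> space P)
        = (\<Prod>i\<in>I. prob ((\<lambda>\<eta>. emeasure \<eta> {f i}) -` S i \<inter> space P))"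
      by (rule indep_varsD_finite[OF ind ne]) (auto simp: I_def S_def)
    then have "prob (\<Inter>i\<in>I. E (f i)) = (\<Prod>i\<in>I. prob (E (f i)))" unfolding pre .
    also have "(\<Inter>i\<in>I. E (f i)) = (\<Inter>c\<in>A \<union> B. E c)" unfolding fI(1)[symmetric] by simp
    also have "(\<Inter>c\<in>A \<union> B. E c) = {\<eta> \<in> space P. (\<forall>c\<in>A. emeasure \<eta> {c} \<ge> 1) \<and> (\<forall>c\<in>B. \<not> emeasure \<eta> {c} \<ge> 1)}"
      unfolding E_def using False fin(3) by (auto split: if_splits)
    also have "(\<Prod>i\<in>I. prob (E (f i))) = (\<Prod>c\<in>A \<union> B. prob (E c))"
      unfolding fI(1)[symmetric] using prod.reindex[OF fI(2), of "\<lambda>c. prob (E c)"] by simp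
    also have "\<dots> = (\<Prod>c\<in>A. prob (E c)) * (\<Prod>c\<in>B. prob (E c))"
      by (rule prod.union_disjoint[OF fin])
    also have "(\<Prod>c\<in>A. prob (E c)) = (\<Prod>c\<in>A. 1 - exp (- measure \<Lambda> {c}))"
    proof (rule prod.cong[OF refl])
      fix c assume "c \<in> A"
      then have "E c = {\<eta> \<in> space P. emeasure \<eta> {c} \<ge> 1}" unfolding E_def by simp
      then show "prob (E c) = 1 - exp (- measure \<Lambda> {c})" using assms(4,5) \<open>c \<in> A\<close> by (simp add: ppp_prob_present)
    qed
    also have "(\<Prod>c\<in>B. prob (E c)) = (\<Prod>c\<in>B. exp (- measure \<Lambda> {c}))"
    proof (rule prod.cong[OF refl])
      fix c assume "c \<in> B"
      then have "E c = {\<eta> \<in> space P. \<not> emeasure \<eta> {c} \<ge> 1}" unfolding E_def using fin(3) by auto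
      then show "prob (E c) = exp (- measure \<Lambda> {c})" using assms(4,5) \<open>c \<in> B\<close> by (simp add: ppp_prob_absent)
    qed
    finally show ?thesis .
  qed
qed

end

text \<open>The items of a list are inspected in turn: from state \<open>s\<close>, an admissible item \<open>c\<close> (\<open>T s c\<close>) that
  is present moves the state to \<open>r c\<close>. The recursion of \<open>reach_prob\<close> has \<open>q c\<close> for the probability
  that \<open>c\<close> is absent.\<close>

fun reaches :: "('s \<Rightarrow> 'a \<Rightarrow> bool) \<Rightarrow> ('a \<Rightarrow> 's) \<Rightarrow> ('s \<Rightarrow> bool) \<Rightarrow> ('a \<Rightarrow> bool) \<Rightarrow> 'a list \<Rightarrow> 's \<Rightarrow> bool" where
  "reaches T r F pr [] s = F s"
| "reaches T r F pr (c # cs) s = (if T s c \<and> pr c then reaches T r F pr cs (r c) else reaches T r F pr cs s)"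

fun reach_prob :: "('s \<Rightarrow> 'a \<Rightarrow> bool) \<Rightarrow> ('a \<Rightarrow> 's) \<Rightarrow> ('s \<Rightarrow> bool) \<Rightarrow> ('a \<Rightarrow> real) \<Rightarrow> 'a list \<Rightarrow> 's \<Rightarrow> real" where
  "reach_prob T r F q [] s = of_bool (F s)"
| "reach_prob T r F q (c # cs) s = (if T s c
     then (1 - q c) * reach_prob T r F q cs (r c) + q c * reach_prob T r F q cs s
     else reach_prob T r F q cs s)"

lemma measurable_reaches:
  assumes "poisson_point_process \<Lambda> P" "\<And>c. c \<in> set cs \<Longrightarrow> {c} \<in> sets \<Lambda>"
  shows "Measurable.pred P (\<lambda>\<eta>. reaches T r F (\<lambda>c. emeasure \<eta> {c} \<ge> 1) cs s)"
  using assms(2)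
proof (induction cs arbitrary: s)
  case (Cons c cs)
  have [measurable]: "(\<lambda>\<eta>. emeasure \<eta> {c}) \<in> borel_measurable P"
    using ppp_measurable[OF assms(1)] Cons.prems by simp
  have [measurable]: "Measurable.pred P (\<lambda>\<eta>. reaches T r F (\<lambda>c. emeasure \<eta> {c} \<ge> 1) cs s)" for s
    using Cons by simp
  show ?case by (cases "T s c") simp_all
qed simp

text \<open>The induction carries a record of the items inspected so far, \<open>A\<close> found
  present and \<open>B\<close> found absent. An admissible head of the list joins one of the two,
  and distinctness makes it new there; the product law for patterns thus does the work of
  conditioning.\<close>

lemma prob_pattern_reaches:
  assumes ppp: "poisson_point_process \<Lambda> P"
    and "finite A" "finite B" "A \<inter> B = {}" "distinct cs" "set cs \<inter> (A \<union> B) = {}"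
    and "\<And>c. c \<in> A \<union> B \<union> set cs \<Longrightarrow> {c} \<in> sets \<Lambda>"
    and "\<And>c. c \<in> A \<union> B \<union> set cs \<Longrightarrow> emeasure \<Lambda> {c} < \<infinity>"
  shows "measure P {\<eta> \<in> space P. (\<forall>c\<in>A. emeasure \<eta> {c} \<ge> 1) \<and> (\<forall>c\<in>B. \<not> emeasure \<eta> {c} \<ge> 1) \<and>
        reaches T r F (\<lambda>c. emeasure \<eta> {c} \<ge> 1) cs s}
     = (\<Prod>c\<in>A. 1 - exp (- measure \<Lambda> {c})) * (\<Prod>c\<in>B. exp (- measure \<Lambda> {c})) *
        reach_prob T r F (\<lambda>c. exp (- measure \<Lambda> {c})) cs s"
  using assms(2-)
proof (induction cs arbitrary: s A B)
  case Nil
  show ?case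
  proof (cases "F s")
    case True
    then show ?thesis using ppp_prob_pattern[OF ppp Nil(1-3)] Nil by simp
  qed simp
next
  case (Cons c cs)
  interpret prob_space P by (rule ppp_prob_space[OF ppp])
  let ?E = "\<lambda>A B s. {\<eta> \<in> space P. (\<forall>c\<in>A. emeasure \<eta> {c} \<ge> 1) \<and> (\<forall>c\<in>B. \<not> emeasure \<eta> {c} \<ge> 1) \<and>
        reaches T r F (\<lambda>c. emeasure \<eta> {c} \<ge> 1) cs s}"
  let ?q = "\<lambda>c. exp (- measure \<Lambda> {c})"
  show ?case
  proof (cases "T s c")
    case False
    then show ?thesis using Cons.IH[of A B s] Cons.prems by auto
  next
    case True
    have nc: "c \<notin> A" "c \<notin> B" using Cons.prems by auto
    have ev: "?E A' B' s' \<in> events" if "A' \<subseteq> insert c A" "B' \<subseteq> insert c B" for A' B' s'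
    proof -
      have [measurable]: "(\<lambda>\<eta>. emeasure \<eta> {c'}) \<in> borel_measurable P" if "c' \<in> A' \<union> B'" for c'
        using ppp_measurable[OF ppp] Cons.prems(6) \<open>A' \<subseteq> _\<close> \<open>B' \<subseteq> _\<close> that by auto
      have [measurable]: "Measurable.pred P (\<lambda>\<eta>. reaches T r F (\<lambda>c. emeasure \<eta> {c} \<ge> 1) cs s')"
        using Cons.prems(6) by (intro measurable_reaches[OF ppp]) auto
      have [simp]: "finite A'" "finite B'" using that Cons.prems(1,2) by (auto intro: finite_subset)
      have [measurable]: "Measurable.pred P (\<lambda>\<eta>. \<forall>c\<in>A'. emeasure \<eta> {c} \<ge> 1)"
        by (rule pred_intros_finite) auto
      have [measurable]: "Measurable.pred P (\<lambda>\<eta>. \<forall>c\<in>B'. \<not> emeasure \<eta> {c} \<ge> 1)"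
        by (rule pred_intros_finite) auto
      show ?thesis by measurable
    qed
    have dec: "{\<eta> \<in> space P. (\<forall>c\<in>A. emeasure \<eta> {c} \<ge> 1) \<and> (\<forall>c\<in>B. \<not> emeasure \<eta> {c} \<ge> 1) \<and>
        reaches T r F (\<lambda>c. emeasure \<eta> {c} \<ge> 1) (c # cs) s} = ?E (insert c A) B (r c) \<union> ?E A (insert c B) s"
      using True by auto
    have disj: "?E (insert c A) B (r c) \<inter> ?E A (insert c B) s = {}" by auto
    have p: "prob (?E (insert c A) B (r c) \<union> ?E A (insert c B) s)
        = prob (?E (insert c A) B (r c)) + prob (?E A (insert c B) s)"
      by (rule finite_measure_Union[OF ev ev disj]) auto
    have p1: "prob (?E (insert c A) B (r c))
        = (\<Prod>c\<in>insert c A. 1 - ?q c) * (\<Prod>c\<in>B. ?q c) * reach_prob T r F ?q cs (r c)"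
      by (rule Cons.IH) (use Cons.prems in auto)
    have p2: "prob (?E A (insert c B) s)
        = (\<Prod>c\<in>A. 1 - ?q c) * (\<Prod>c\<in>insert c B. ?q c) * reach_prob T r F ?q cs s"
      by (rule Cons.IH) (use Cons.prems in auto)
    have i1: "(\<Prod>c\<in>insert c A. 1 - ?q c) = (1 - ?q c) * (\<Prod>c\<in>A. 1 - ?q c)"
      and i2: "(\<Prod>c\<in>insert c B. ?q c) = ?q c * (\<Prod>c\<in>B. ?q c)"
      using nc Cons.prems(1,2) by simp_all
    have comb: "reach_prob T r F ?q (c # cs) s = (1 - ?q c) * reach_prob T r F ?q cs (r c) + ?q c * reach_prob T r F ?q cs s"
      using True by simp
    have alg: "(1 - x) * a * b * u + a * (x * b) * v = a * b * ((1 - x) * u + x * v)" for x a b u v :: real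
      by (simp add: algebra_simps)
    show ?thesis unfolding dec p p1 p2 i1 i2 comb by (rule alg)
  qed
qed

lemma prob_reaches:
  assumes "poisson_point_process \<Lambda> P" "distinct cs"
    and "\<And>c. c \<in> set cs \<Longrightarrow> {c} \<in> sets \<Lambda>" "\<And>c. c \<in> set cs \<Longrightarrow> emeasure \<Lambda> {c} < \<infinity>"
  shows "measure P {\<eta> \<in> space P. reaches T r F (\<lambda>c. emeasure \<eta> {c} \<ge> 1) cs s}
     = reach_prob T r F (\<lambda>c. exp (- measure \<Lambda> {c})) cs s"
  using prob_pattern_reaches[OF assms(1), of "{}" "{}" cs T r F s] assms(2-) by simp

lemma reach_prob_no_move:
  "(\<And>c. c \<in> set cs \<Longrightarrow> \<not> T s c) \<Longrightarrow> reach_prob T r F q (cs @ rest) s = reach_prob T r F q rest s"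
  by (induction cs) auto

text \<open>The product is the probability that all admissible items of the block are absent; then
  the state stays \<open>s\<close> and \<open>v0\<close> applies. Otherwise the first present one
  moves the state to some \<open>r c\<close>, from which the block allows no further move, and
  \<open>v1\<close> applies.\<close>

lemma reach_prob_block:
  assumes "\<And>c. 0 \<le> q c \<and> q c \<le> 1" "distinct cs"
    and "\<And>c c'. c \<in> set cs \<Longrightarrow> c' \<in> set cs \<Longrightarrow> \<not> T (r c) c'"
    and "\<And>c. c \<in> set cs \<Longrightarrow> v1 \<le> reach_prob T r F q rest (r c)"
    and "v0 \<le> reach_prob T r F q rest s"
  shows "v0 * (\<Prod>c\<in>{c \<in> set cs. T s c}. q c) + v1 * (1 - (\<Prod>c\<in>{c \<in> set cs. T s c}. q c))
     \<le> reach_prob T r F q (cs @ rest) s"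
  using assms(2-4)
proof (induction cs)
  case Nil
  then show ?case using assms(5) by simp
next
  case (Cons c cs)
  define Q where "Q = (\<Prod>c\<in>{c \<in> set cs. T s c}. q c)"
  have IH: "v0 * Q + v1 * (1 - Q) \<le> reach_prob T r F q (cs @ rest) s"
    unfolding Q_def using Cons.prems by (intro Cons.IH) auto
  show ?case
  proof (cases "T s c")
    case False
    then have "{c' \<in> set (c # cs). T s c'} = {c' \<in> set cs. T s c'}" by auto
    then show ?thesis using False IH unfolding Q_def by simp
  next
    case True
    have "{c' \<in> set (c # cs). T s c'} = insert c {c' \<in> set cs. T s c'}" using True by auto
    then have pr: "(\<Prod>c'\<in>{c' \<in> set (c # cs). T s c'}. q c') = q c * Q"
      unfolding Q_def using Cons.prems(1) by simp
    have "reach_prob T r F q (cs @ rest) (r c) = reach_prob T r F q rest (r c)"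
      using Cons.prems(2) by (intro reach_prob_no_move) auto
    then have v1: "v1 \<le> reach_prob T r F q (cs @ rest) (r c)" using Cons.prems(3)[of c] by simp
    have "(1 - q c) * v1 + q c * (v0 * Q + v1 * (1 - Q)) \<le> reach_prob T r F q ((c # cs) @ rest) s"
      using True assms(1)[of c] v1 IH by (simp add: add_mono mult_left_mono)
    then show ?thesis unfolding pr by (simp add: algebra_simps)
  qed
qed

section \<open>Loops at a given scale\<close>

lemma adj_irrefl: "\<not> adj x x"
  unfolding adj_def by simp

lemma closed_walks_based:
  assumes "l \<in> closed_walks L" "L \<ge> 2" shows "l \<in> based_loops"
proof -
  have "l ! i \<noteq> l ! (Suc i mod length l)" if "i < length l" for i
  proof -
    have "adj (l ! i) (l ! (Suc i mod length l))" using assms(1) that unfolding closed_walks_def by auto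
    then show ?thesis using adj_irrefl by metis
  qed
  then show ?thesis using assms unfolding closed_walks_def based_loops_def by auto
qed

abbreviation loop_class :: "(int ^ 3) list \<Rightarrow> (int ^ 3) list set" where
  "loop_class l \<equiv> rotation_rel `` {l}"

lemma mem_loop_class: "l \<in> based_loops \<Longrightarrow> l' \<in> loop_class l \<longleftrightarrow> (\<exists>k. l' = rotate k l)"
  unfolding rotation_rel_def by auto

lemma loop_class_refl: "l \<in> based_loops \<Longrightarrow> l \<in> loop_class l"
  unfolding mem_loop_class by (metis rotate0 id_apply)

text \<open>Length, vertex set and \<open>good\<close> are invariant under rotation, so any
  representative can serve as state of the exploration.\<close>

definition rep :: "(int ^ 3) list set \<Rightarrow> (int ^ 3) list" where
  "rep c = (SOME l. l \<in> c)"

lemma rep_in: "l \<in> based_loops \<Longrightarrow> rep (loop_class l) \<in> loop_class l"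
  unfolding rep_def using loop_class_refl by (rule someI)

lemma rep_loop_class:
  assumes "l \<in> based_loops" obtains k where "rep (loop_class l) = rotate k l"
  using rep_in[OF assms] assms unfolding mem_loop_class[OF assms] by blast

lemma sets_loop_measure: "sets loop_measure = Pow loops"
  by (simp add: loop_measure_def)

text \<open>As \<open>A\<close> is closed under rotation, the preimage of its classes is
  \<open>A\<close> itself. The mass becomes a sum over based loops, and loops with a period need no
  separate count.\<close>

lemma emeasure_loop_class_image:
  assumes "finite A" and cw: "\<And>l. l \<in> A \<Longrightarrow> \<exists>L\<ge>2. l \<in> closed_walks L" and rot: "\<And>l i. l \<in> A \<Longrightarrow> rotate i l \<in> A"
  shows "loop_class ` A \<subseteq> loops"
    "emeasure loop_measure (loop_class ` A) = ennreal (\<Sum>l\<in>A. 1 / (real (length l) * 6 ^ length l))"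
proof -
  have bl: "l \<in> based_loops" if "l \<in> A" for l using cw[OF that] closed_walks_based by blast
  then show sub: "loop_class ` A \<subseteq> loops" unfolding loops_def by (auto intro: quotientI)
  let ?w = "\<lambda>l. 1 / real (length l) * (\<Prod>i<length l. Q (l ! i) (l ! (Suc i mod length l))) :: real"
  have pre: "(\<lambda>l. loop_class l) -` (loop_class ` A) \<inter> based_loops = A"
  proof -
    have "l \<in> A" if l: "l \<in> based_loops" and a: "a \<in> A" and eq: "loop_class l = loop_class a" for l a
    proof -
      have "l \<in> loop_class a" using loop_class_refl[OF l] eq by simp
      then obtain k where "l = rotate k a" using mem_loop_class[OF bl[OF a]] by blast
      then show ?thesis using rot a by simp
    qed
    then show ?thesis using bl by blast
  qed
  have meas: "(\<lambda>l. loop_class l) \<in> measurable based_loop_measure (count_space loops)"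
    unfolding based_loop_measure_def loops_def by (auto simp: quotientI)
  have "emeasure loop_measure (loop_class ` A) = emeasure based_loop_measure ((\<lambda>l. loop_class l) -` (loop_class ` A) \<inter> space based_loop_measure)"
    unfolding loop_measure_def by (rule emeasure_distr[OF meas]) (use sub in simp)
  also have "\<dots> = emeasure based_loop_measure A"
    using pre by (simp add: based_loop_measure_def space_point_measure)
  also have "\<dots> = (\<Sum>l\<in>A. ennreal (?w l))"
    unfolding based_loop_measure_def using bl assms(1) by (intro emeasure_point_measure_finite2) auto
  also have "\<dots> = (\<Sum>l\<in>A. ennreal (1 / (real (length l) * 6 ^ length l)))"
  proof (rule sum.cong[OF refl])
    fix l assume "l \<in> A"
    then have "\<forall>i<length l. adj (l ! i) (l ! (Suc i mod length l))"
      using cw unfolding closed_walks_def by blast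
    then have "(\<Prod>i<length l. Q (l ! i) (l ! (Suc i mod length l))) = (\<Prod>i<length l. 1 / 6)"
      by (intro prod.cong) (auto simp: Q_def)
    then show "ennreal (?w l) = ennreal (1 / (real (length l) * 6 ^ length l))"
      by (simp add: power_divide)
  qed
  also have "\<dots> = ennreal (\<Sum>l\<in>A. 1 / (real (length l) * 6 ^ length l))"
    by (rule sum_ennreal) simp
  finally show "emeasure loop_measure (loop_class ` A) = ennreal (\<Sum>l\<in>A. 1 / (real (length l) * 6 ^ length l))" .
qed

text \<open>A rotation brings \<open>v\<close> to time 0, from where \<open>u\<close> is reached in
  fewer than \<open>L\<close> unit steps.\<close>

lemma closed_walk_diam:
  assumes l: "l \<in> closed_walks L" and "u \<in> set l" "v \<in> set l"
  shows "\<bar>u $ j - v $ j\<bar> \<le> int L"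
proof -
  have len: "length l = L" using l unfolding closed_walks_def by simp
  obtain a where a: "a < L" "v = l ! a" using assms(3) len by (metis in_set_conv_nth)
  let ?r = "rotate a l"
  have r: "?r \<in> closed_walks L" using closed_walks_rotate[OF l] .
  have r0: "?r ! 0 = v" using a len by (simp add: nth_rotate)
  have step: "\<bar>x $ j - y $ j\<bar> \<le> 1" if "adj x y" for x y :: "int ^ 3"
  proof -
    have "\<bar>x $ j - y $ j\<bar> \<le> (\<Sum>i\<in>UNIV. \<bar>x $ i - y $ i\<bar>)" by (rule member_le_sum) auto
    then show ?thesis using that unfolding adj_def by simp
  qed
  have "\<bar>?r ! m $ j - v $ j\<bar> \<le> int m" if "m < L" for m
    using that
  proof (induction m)
    case (Suc m)
    have "\<forall>i<L. adj (?r ! i) (?r ! (Suc i mod L))" using r unfolding closed_walks_def by simp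
    from this[rule_format, of m] have "adj (?r ! m) (?r ! Suc m)" using Suc.prems by simp
    from step[OF this] Suc show ?case by simp
  qed (simp add: r0)
  moreover obtain m where "m < L" "u = ?r ! m"
    using assms(2) len by (metis in_set_conv_nth length_rotate set_rotate)
  ultimately have "\<bar>u $ j - v $ j\<bar> \<le> int m" by blast
  then show ?thesis using \<open>m < L\<close> by linarith
qed

section \<open>Loops of one scale and the mass of those that meet a given list\<close>

text \<open>Closed walks have even length. The gap between consecutive windows separates the lengths
  of different scales by a factor of more than 2.\<close>

definition window :: "nat \<Rightarrow> nat set" where
  "window k = (\<lambda>h. 2 * h) ` {4 ^ k div 2..<4 ^ k}"

lemma windowD:
  assumes "L \<in> window k" "k \<ge> 1" shows "even L" "4 ^ k \<le> L" "L < 2 * 4 ^ k" "L \<ge> 2"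
proof -
  have e: "2 * (4 ^ k div 2) = (4::nat) ^ k" using assms(2) by simp
  have "(4::nat) ^ 1 \<le> 4 ^ k" using assms(2) by (intro power_increasing) auto
  then show "even L" "4 ^ k \<le> L" "L < 2 * 4 ^ k" "L \<ge> 2"
    using assms(1) e unfolding window_def by auto
qed

lemma card_window: "k \<ge> 1 \<Longrightarrow> real (card (window k)) = 4 ^ k / 2"
proof -
  assume k: "k \<ge> 1"
  have e: "2 * (4 ^ k div 2) = (4::nat) ^ k" using k by simp
  have "2 * card (window k) = 4 ^ k"
    unfolding window_def using e by (subst card_image) (auto simp: inj_on_def)
  then have "real (2 * card (window k)) = real (4 ^ k)" by (simp only:)
  then show ?thesis by simp
qed

text \<open>The truncation time exceeds all lengths up to scale \<open>M\<close>, as the bridge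
  bounds require, and is the same for all \<open>k\<close>, so a loop found at one scale is a valid
  starting point at the next.\<close>

definition good :: "nat \<Rightarrow> nat \<Rightarrow> nat \<Rightarrow> (int ^ 3) list \<Rightarrow> bool" where
  "good n M k l \<longleftrightarrow> low_energy (2 * 4 ^ M) l \<and> (k = M \<longrightarrow> \<not> set l \<subseteq> lattice_box 0 n)"

lemma good_rotate: "good n M k (rotate i l) = good n M k l"
  unfolding good_def low_energy_def energy_rotate by simp

text \<open>The box, which every loop met by the exploration stays in, only makes the block finite.\<close>

definition block :: "nat \<Rightarrow> nat \<Rightarrow> nat \<Rightarrow> (int ^ 3) list set" where
  "block n M k = {l. length l \<in> window k \<and> l \<in> closed_walks (length l) \<and> good n M k l \<and> set l \<subseteq> lattice_box 0 (4 ^ Suc k)}"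

lemma finite_block: "finite (block n M k)"
proof (rule finite_subset)
  show "block n M k \<subseteq> {l. set l \<subseteq> lattice_box 0 (4 ^ Suc k) \<and> length l \<le> 2 * 4 ^ k}"
    unfolding block_def window_def by auto
  show "finite {l :: (int ^ 3) list. set l \<subseteq> lattice_box 0 (4 ^ Suc k) \<and> length l \<le> 2 * 4 ^ k}"
    by (rule finite_lists_length_le[OF finite_lattice_box])
qed

lemma block_rotate: "l \<in> block n M k \<Longrightarrow> rotate i l \<in> block n M k"
  unfolding block_def by (simp add: good_rotate closed_walks_rotate)

lemma block_based: "l \<in> block n M k \<Longrightarrow> k \<ge> 1 \<Longrightarrow> l \<in> based_loops"
  using closed_walks_based windowD(4) unfolding block_def by blast

text \<open>The invariant of the exploration before scale \<open>k\<close>. With the factor 2, a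
  move to a loop of scale \<open>k\<close> at least doubles the length.\<close>

definition explorable :: "nat \<Rightarrow> nat \<Rightarrow> (int ^ 3) list \<Rightarrow> bool" where
  "explorable M k \<kappa> \<longleftrightarrow> \<kappa> \<noteq> [] \<and> low_energy (2 * 4 ^ M) \<kappa> \<and> 2 * length \<kappa> \<le> 4 ^ k \<and> set \<kappa> \<subseteq> lattice_box 0 (4 ^ k)"

lemma lattice_box_mono: "m \<le> n \<Longrightarrow> lattice_box x m \<subseteq> lattice_box (x :: int ^ 3) n"
proof
  fix y assume "m \<le> n" "y \<in> lattice_box x m"
  then show "y \<in> lattice_box x n" unfolding mem_lattice_box by (meson of_nat_mono order_trans)
qed

lemma touching_walks_block:
  assumes "L \<in> window k" "k \<ge> 1" "explorable M k \<kappa>"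
  shows "touching_walks L (good n M k) \<kappa> \<subseteq> {l \<in> block n M k. set l \<inter> set \<kappa> \<noteq> {}}"
proof
  fix l assume "l \<in> touching_walks L (good n M k) \<kappa>"
  then have l: "l \<in> closed_walks L" "good n M k l" "length l = L" and "set l \<inter> set \<kappa> \<noteq> {}"
    unfolding touching_walks_def closed_walks_def by auto
  then obtain v where v: "v \<in> set l" "v \<in> set \<kappa>" by blast
  have "set l \<subseteq> lattice_box 0 (4 ^ Suc k)"
  proof
    fix u assume u: "u \<in> set l"
    have "\<bar>u $ j\<bar> \<le> int (4 ^ Suc k)" for j
    proof -
      \<comment> \<open>The radius of the box comes from
        \<open>4 ^ k + 2 * 4 ^ k < 4 ^ Suc k\<close>.\<close>
      have "\<bar>u $ j - v $ j\<bar> \<le> int L" using closed_walk_diam[OF l(1) u v(1)] .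
      moreover have "\<bar>v $ j\<bar> \<le> int (4 ^ k)"
        using assms(3) v(2) unfolding explorable_def by (auto simp: mem_lattice_box)
      moreover have "int L < 2 * int (4 ^ k)" using windowD(3)[OF assms(1,2)] by (simp flip: of_nat_power)
      ultimately show ?thesis by simp
    qed
    then show "u \<in> lattice_box 0 (4 ^ Suc k)" unfolding mem_lattice_box by simp
  qed
  then show "l \<in> {l \<in> block n M k. set l \<inter> set \<kappa> \<noteq> {}}"
    unfolding block_def using l v assms(1) by auto
qed

text \<open>High energy and, at the last scale, confinement cost 1/1296 each, together half of the
  lower bound 1/324 for all bridges.\<close>

lemma bad_bridges:
  assumes "even L" "L > 0" "n > 0" "k = M \<Longrightarrow> sqrt (real L) \<ge> 216 * real n"
  shows "real (card {l \<in> bridges L x. \<not> good n M k l}) \<le> 6 ^ L / (648 * pow32 L)"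
proof -
  let ?E = "{l \<in> bridges L x. \<not> low_energy (2 * 4 ^ M) l}"
  let ?C = "{l \<in> bridges L x. k = M \<and> set l \<subseteq> lattice_box 0 n}"
  have fin: "finite (bridges L x)" using finite_bridges assms(2) by simp
  have "{l \<in> bridges L x. \<not> good n M k l} = ?E \<union> ?C" unfolding good_def by auto
  then have "real (card {l \<in> bridges L x. \<not> good n M k l}) \<le> real (card ?E) + real (card ?C)"
    using card_Un_le[of ?E ?C] by (simp flip: of_nat_add)
  moreover have "real (card ?C) \<le> 6 ^ L / (1296 * pow32 L)"
  proof (cases "k = M")
    case True
    then show ?thesis using card_confined[OF assms(1-3) assms(4)] by simp
  qed simp
  moreover have "real (card ?E) \<le> 6 ^ L / (1296 * pow32 L)" by (rule card_high_energy[OF assms(2)])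
  ultimately show ?thesis by simp
qed

lemma pow32_4: "pow32 (4 ^ k) = 8 ^ k"
proof -
  have "sqrt (4 ^ k) = 2 ^ k" by (simp add: real_sqrt_power)
  then have "pow32 (4 ^ k) = 4 ^ k * 2 ^ k" unfolding pow32_def by simp
  then show ?thesis by (simp flip: power_mult_distrib)
qed

text \<open>Each of the \<open>4 ^ k / 2\<close> lengths of the window contributes at least
  \<open>touch_const * s / (3 * 8 ^ k)\<close> with \<open>s = sqrt (length \<kappa>)\<close>; the 3
  comes from \<open>pow32 L \<le> 3 * pow32 (4 ^ k)\<close>.\<close>

lemma block_mass:
  assumes "1 \<le> k" "k \<le> M" "n > 0" "2 ^ M \<ge> 216 * real n" "explorable M k \<kappa>"
  shows "(\<Sum>l\<in>{l \<in> block n M k. set l \<inter> set \<kappa> \<noteq> {}}. 1 / (real (length l) * 6 ^ length l))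
    \<ge> touch_const / 6 * (sqrt (real (length \<kappa>)) / 2 ^ k)"
proof -
  let ?A = "{l \<in> block n M k. set l \<inter> set \<kappa> \<noteq> {}}"
  let ?T = "\<lambda>L. touching_walks L (good n M k) \<kappa>"
  let ?w = "\<lambda>l. 1 / (real (length l) * 6 ^ length l) :: real"
  define s where "s = sqrt (real (length \<kappa>))"
  have finT: "finite (?T L)" if "L \<in> window k" for L
    using finite_touching_walks windowD(4)[OF that assms(1)] by simp
  have one: "touch_const * s / (3 * 8 ^ k) \<le> (\<Sum>l\<in>?T L. ?w l)" if L: "L \<in> window k" for L
  proof -
    note w = windowD[OF L assms(1)]
    have "(4::nat) ^ k \<le> 4 ^ M" using assms(2) by (intro power_increasing) auto
    then have K: "2 * 4 ^ M > L" using w(3) by linarith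
    have L0: "L > 0" using w(4) by simp
    have big: "sqrt (real L) \<ge> 216 * real n" if "k = M"
    proof -
      have "real (4 ^ k) \<le> real L" using w(2) by (simp only: of_nat_le_iff)
      then have "sqrt (4 ^ k) \<le> sqrt (real L)" by simp
      then show ?thesis using assms(4) that by (simp add: real_sqrt_power)
    qed
    have "touch_const * real L * 6 ^ L * sqrt (real (length \<kappa>)) / pow32 L \<le> real (card (?T L))"
      using assms(5) unfolding explorable_def
      by (intro card_touching_walks[OF L0 K w(1)] good_rotate bad_bridges[OF w(1) L0 assms(3) big]) auto
    then have a: "touch_const * real L * 6 ^ L * s / pow32 L \<le> real (card (?T L))" unfolding s_def .
    have "touch_const * s / (3 * 8 ^ k) \<le> touch_const * s / pow32 L"
    proof (rule divide_left_mono)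
      show "pow32 L \<le> 3 * 8 ^ k" using pow32_double_le[of L "4 ^ k"] w(3) pow32_4[of k] by simp
    qed (use touch_const_pos L0 in \<open>auto simp: s_def intro!: mult_nonneg_nonneg mult_pos_pos\<close>)
    also have "\<dots> = touch_const * real L * 6 ^ L * s / pow32 L * (1 / (real L * 6 ^ L))" using L0 by simp
    also have "\<dots> \<le> real (card (?T L)) * (1 / (real L * 6 ^ L))" by (intro mult_right_mono a) auto
    also have "\<dots> = (\<Sum>l\<in>?T L. 1 / (real L * 6 ^ L))" by simp
    also have "\<dots> = (\<Sum>l\<in>?T L. ?w l)"
      by (rule sum.cong[OF refl]) (auto simp: touching_walks_def closed_walks_def)
    finally show ?thesis .
  qed
  have "touch_const / 6 * (s / 2 ^ k) = real (card (window k)) * (touch_const * s / (3 * 8 ^ k))"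
  proof -
    have "(8::real) ^ k = 4 ^ k * 2 ^ k" by (simp flip: power_mult_distrib)
    then show ?thesis unfolding card_window[OF assms(1)] by simp
  qed
  also have "\<dots> = (\<Sum>L\<in>window k. touch_const * s / (3 * 8 ^ k))" by simp
  also have "\<dots> \<le> (\<Sum>L\<in>window k. \<Sum>l\<in>?T L. ?w l)" by (intro sum_mono one)
  also have "\<dots> = (\<Sum>l\<in>(\<Union>L\<in>window k. ?T L). ?w l)"
  proof (rule sum.UNION_disjoint[symmetric])
    show "finite (window k)" unfolding window_def by simp
    show "\<forall>i\<in>window k. finite (?T i)" using finT by simp
    show "\<forall>i\<in>window k. \<forall>j\<in>window k. i \<noteq> j \<longrightarrow> ?T i \<inter> ?T j = {}"
      by (auto simp: touching_walks_def closed_walks_def)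
  qed
  also have "\<dots> \<le> (\<Sum>l\<in>?A. ?w l)"
    using touching_walks_block[OF _ assms(1,5)] finite_block by (intro sum_mono2) auto
  finally show ?thesis unfolding s_def .
qed

section \<open>The multi-scale exploration\<close>

text \<open>Any order within a scale will do, as the bound of \<open>reach_prob_block\<close> is the
  same for all of them.\<close>

definition block_list :: "nat \<Rightarrow> nat \<Rightarrow> nat \<Rightarrow> (int ^ 3) list set list" where
  "block_list n M k = (SOME cs. distinct cs \<and> set cs = loop_class ` block n M k)"

lemma block_list: "distinct (block_list n M k)" "set (block_list n M k) = loop_class ` block n M k"
proof -
  have "\<exists>cs. distinct cs \<and> set cs = loop_class ` block n M k"
    using finite_distinct_list[OF finite_imageI[OF finite_block]] by metis
  then have "distinct (block_list n M k) \<and> set (block_list n M k) = loop_class ` block n M k"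
    unfolding block_list_def by (rule someI_ex)
  then show "distinct (block_list n M k)" "set (block_list n M k) = loop_class ` block n M k" by auto
qed

text \<open>The condition on the lengths forbids moves between loops of the same scale.\<close>

definition touches :: "(int ^ 3) list \<Rightarrow> (int ^ 3) list set \<Rightarrow> bool" where
  "touches \<kappa> c \<longleftrightarrow> set \<kappa> \<inter> set (rep c) \<noteq> {} \<and> 2 * length \<kappa> \<le> length (rep c)"

lemma rep_block:
  assumes "l \<in> block n M k" "k \<ge> 1"
  shows "rep (loop_class l) \<in> block n M k" "set (rep (loop_class l)) = set l" "length (rep (loop_class l)) = length l"
proof -
  obtain i where "rep (loop_class l) = rotate i l"
    using rep_loop_class block_based assms by blast
  then show "rep (loop_class l) \<in> block n M k" "set (rep (loop_class l)) = set l" "length (rep (loop_class l)) = length l"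
    using block_rotate[OF assms(1)] by auto
qed

lemma rep_block_list: "c \<in> set (block_list n M k) \<Longrightarrow> k \<ge> 1 \<Longrightarrow> rep c \<in> block n M k"
  unfolding block_list(2) using rep_block(1) by auto

lemma blockD:
  assumes "l \<in> block n M k" "k \<ge> 1"
  shows "4 ^ k \<le> length l" "length l < 2 * 4 ^ k" "length l \<ge> 2" "l \<in> closed_walks (length l)" "good n M k l"
    "set l \<subseteq> lattice_box 0 (4 ^ Suc k)"
  using assms windowD unfolding block_def by auto

definition exploration :: "nat \<Rightarrow> nat \<Rightarrow> nat \<Rightarrow> (int ^ 3) list set list" where
  "exploration n M k = concat (map (block_list n M) [k..<Suc M])"

lemma set_exploration: "set (exploration n M k) = (\<Union>j\<in>{k..M}. set (block_list n M j))"
  unfolding exploration_def by (auto simp: less_Suc_eq_le simp del: upt_Suc)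

text \<open>Lengths tell the scales apart: below \<open>2 * 4 ^ j\<close> at scale \<open>j\<close>,
  at least \<open>4 ^ m\<close> at a later scale \<open>m\<close>.\<close>

lemma distinct_exploration: "k \<ge> 1 \<Longrightarrow> distinct (exploration n M k)"
proof -
  assume k: "k \<ge> 1"
  have "distinct (concat (map (block_list n M) [k..<m]))" for m
  proof (induction m)
    case (Suc m)
    show ?case
    proof (cases "k \<le> m")
      case True
      have dj: "set (block_list n M j) \<inter> set (block_list n M m) = {}" if "k \<le> j" "j < m" for j
      proof -
        have "False" if c: "c \<in> set (block_list n M j)" "c \<in> set (block_list n M m)" for c
        proof -
          have "length (rep c) < 2 * 4 ^ j" "4 ^ m \<le> length (rep c)"
            using blockD(2)[OF rep_block_list[OF c(1)]] blockD(1)[OF rep_block_list[OF c(2)]] k \<open>k \<le> j\<close> True by auto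
          moreover have "(4::nat) ^ Suc j \<le> 4 ^ m" using \<open>j < m\<close> by (intro power_increasing) auto
          ultimately show False by simp
        qed
        then show ?thesis by blast
      qed
      then have "(\<Union>j\<in>{k..<m}. set (block_list n M j)) \<inter> set (block_list n M m) = {}"
        using dj[unfolded disjoint_iff] unfolding disjoint_iff by auto
      then show ?thesis using Suc True block_list(1) by simp
    qed simp
  qed simp
  then show ?thesis unfolding exploration_def .
qed

lemma exploration_Suc: "k \<le> M \<Longrightarrow> exploration n M k = block_list n M k @ exploration n M (Suc k)"
  unfolding exploration_def by (subst upt_conv_Cons) auto

lemma emeasure_loop_singleton:
  assumes "l \<in> block n M k" "k \<ge> 1" shows "emeasure loop_measure {loop_class l} < \<infinity>"
proof -
  have cw: "\<And>l. l \<in> block n M k \<Longrightarrow> \<exists>L\<ge>2. l \<in> closed_walks L" using blockD(3,4) assms(2) by blast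
  note e = emeasure_loop_class_image[OF finite_block cw block_rotate, of n M k]
  have "emeasure loop_measure {loop_class l} \<le> emeasure loop_measure (loop_class ` block n M k)"
    using assms(1) e(1) by (intro emeasure_mono) (auto simp: sets_loop_measure)
  also have "\<dots> < \<infinity>" using e(2) by simp
  finally show ?thesis .
qed

definition absent :: "real \<Rightarrow> (int ^ 3) list set \<Rightarrow> real" where
  "absent \<alpha> c = exp (- measure (scale_measure (ennreal \<alpha>) loop_measure) {c})"

lemma absent_bounds: "0 \<le> absent \<alpha> c \<and> absent \<alpha> c \<le> 1"
  unfolding absent_def by simp

section \<open>Success at one scale and growth over all scales\<close>

text \<open>With \<open>a = \<alpha> * touch_const / 6\<close>, this is a slope for which
  \<open>1 - exp (- a * x) \<ge> gain \<alpha> * x\<close> on \<open>[0, 1]\<close>; it comes from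
  \<open>exp (- y) \<le> 1 / (1 + y)\<close>.\<close>

definition gain :: "real \<Rightarrow> real" where
  "gain \<alpha> = (\<alpha> * (touch_const / 6)) / (1 + \<alpha> * (touch_const / 6))"

lemma gain_pos: "\<alpha> > 0 \<Longrightarrow> gain \<alpha> > 0"
  unfolding gain_def using touch_const_pos by (simp add: add_pos_pos)

lemma block_hit_prob:
  assumes "\<alpha> > 0" "1 \<le> k" "k \<le> M" "n > 0" "2 ^ M \<ge> 216 * real n" "explorable M k \<kappa>"
  shows "(\<Prod>c\<in>{c \<in> set (block_list n M k). touches \<kappa> c}. absent \<alpha> c)
    \<le> 1 - gain \<alpha> * (sqrt (real (length \<kappa>)) / 2 ^ k)"
proof -
  let ?A = "{l \<in> block n M k. set l \<inter> set \<kappa> \<noteq> {}}"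
  let ?T = "{c \<in> set (block_list n M k). touches \<kappa> c}"
  define a where "a = \<alpha> * (touch_const / 6)"
  define x where "x = sqrt (real (length \<kappa>)) / 2 ^ k"
  have a: "a > 0" unfolding a_def using assms(1) touch_const_pos by simp
  have x: "0 \<le> x" "x \<le> 1"
  proof -
    have "length \<kappa> \<le> 4 ^ k" using assms(6) unfolding explorable_def by auto
    then have "real (length \<kappa>) \<le> real (4 ^ k)" by (simp only: of_nat_le_iff)
    then have "sqrt (real (length \<kappa>)) \<le> sqrt (4 ^ k)" by simp
    then show "0 \<le> x" "x \<le> 1" unfolding x_def by (simp_all add: real_sqrt_power)
  qed
  \<comment> \<open>Explorability supplies the length condition of \<open>touches\<close>, since
    loops of the block have length at least \<open>4 ^ k\<close>.\<close>
  have T: "?T = loop_class ` ?A"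
  proof -
    have "touches \<kappa> (loop_class l) \<longleftrightarrow> set l \<inter> set \<kappa> \<noteq> {}" if "l \<in> block n M k" for l
      using rep_block[OF that assms(2)] blockD(1)[OF that assms(2)] assms(6)
      unfolding touches_def explorable_def by auto
    then show ?thesis unfolding block_list(2) by auto
  qed
  have finA: "finite ?A" using finite_block by simp
  have cw: "\<And>l. l \<in> ?A \<Longrightarrow> \<exists>L\<ge>2. l \<in> closed_walks L" using blockD(3,4) assms(2) by blast
  have rot: "\<And>l i. l \<in> ?A \<Longrightarrow> rotate i l \<in> ?A" using block_rotate by simp
  note e = emeasure_loop_class_image[OF finA cw rot]
  have "measure loop_measure ?T = (\<Sum>l\<in>?A. 1 / (real (length l) * 6 ^ length l))"
    unfolding T by (rule measure_eq_emeasure_eq_ennreal[OF _ e(2)]) (auto intro: sum_nonneg)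
  also have "\<dots> \<ge> touch_const / 6 * x" unfolding x_def by (rule block_mass[OF assms(2-6)])
  finally have mass: "touch_const / 6 * x \<le> measure loop_measure ?T" .
  have sum: "measure loop_measure ?T = (\<Sum>c\<in>?T. measure loop_measure {c})"
  proof (rule measure_eq_sum_singleton)
    show "{c} \<in> sets loop_measure" if "c \<in> ?T" for c
      using that e(1) unfolding T sets_loop_measure by auto
    show "emeasure loop_measure {c} \<noteq> \<infinity>" if "c \<in> ?T" for c
      using that emeasure_loop_singleton[OF _ assms(2)] unfolding T by force
  qed simp
  have "(\<Prod>c\<in>?T. absent \<alpha> c) = exp (- (\<alpha> * measure loop_measure ?T))"
    unfolding sum absent_def using assms(1)
    by (simp add: exp_sum[symmetric] sum_negf sum_distrib_left)
  also have "\<dots> \<le> exp (- (a * x))"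
    using mult_left_mono[OF mass, of \<alpha>] assms(1) unfolding a_def by (simp add: mult.assoc)
  also have "\<dots> \<le> 1 / (1 + a * x)"
  proof -
    have "1 + a * x \<le> exp (a * x)" by (rule exp_ge_add_one_self)
    moreover have "1 + a * x > 0" using a x by (simp add: add_pos_nonneg)
    ultimately show ?thesis by (simp add: exp_minus inverse_eq_divide frac_le)
  qed
  also have "\<dots> \<le> 1 - a / (1 + a) * x"
  proof -
    have "a * x \<le> a * 1" using a x by (intro mult_left_mono) auto
    then have "a * x / (1 + a) \<le> a * x / (1 + a * x)"
      using a x by (intro divide_left_mono) (auto simp: add_pos_nonneg)
    moreover have "1 / (1 + a * x) = 1 - a * x / (1 + a * x)"
    proof -
      have "1 + a * x \<noteq> 0" using a x by (smt (verit) mult_nonneg_nonneg)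
      then show ?thesis by (simp add: field_simps)
    qed
    ultimately show ?thesis by simp
  qed
  finally show ?thesis unfolding gain_def a_def x_def .
qed

abbreviation escaped :: "nat \<Rightarrow> (int ^ 3) list \<Rightarrow> bool" where
  "escaped n \<kappa> \<equiv> \<not> set \<kappa> \<subseteq> lattice_box 0 n"

text \<open>3/4 is a rational bound above \<open>1 / sqrt 2\<close>. The remaining quarter of
  \<open>2 ^ k\<close> is the least increase in a move and gives the 4 in
  \<open>1 + gain \<alpha> / 4\<close>.\<close>

lemma sqrt_explorable_le:
  assumes "explorable M k \<kappa>" shows "sqrt (real (length \<kappa>)) \<le> 3/4 * 2 ^ k"
proof -
  have "2 * length \<kappa> \<le> 4 ^ k" using assms unfolding explorable_def by simp
  then have "real (2 * length \<kappa>) \<le> real (4 ^ k)" by (simp only: of_nat_le_iff)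
  then have "real (length \<kappa>) \<le> (3/4)\<^sup>2 * 4 ^ k" by (simp add: power2_eq_square)
  also have "\<dots> = (3/4 * 2 ^ k)\<^sup>2"
  proof -
    have "(2 ^ k)\<^sup>2 = (4::real) ^ k" by (simp add: power2_eq_square flip: power_mult_distrib)
    then show ?thesis by (simp only: power_mult_distrib)
  qed
  finally have le: "real (length \<kappa>) \<le> (3/4 * 2 ^ k)\<^sup>2" .
  show ?thesis by (rule real_le_lsqrt[OF _ le]) simp
qed

text \<open>Downward induction on \<open>k\<close>. With \<open>s = sqrt (length \<kappa>)\<close>,
  a move at scale \<open>k\<close> has probability at least \<open>gain \<alpha> * s / 2 ^ k\<close>
  and raises the square root of the length by at least \<open>2 ^ k / 4\<close>. The product
  \<open>gain \<alpha> / 4 * s\<close> has the same ratio to \<open>s\<close> at every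
  scale.\<close>

lemma reach_prob_lower:
  assumes "\<alpha> > 0" "n > 0" "2 ^ M \<ge> 216 * real n" "1 \<le> k" "k \<le> M" "explorable M k \<kappa>"
  shows "reach_prob touches rep (escaped n) (absent \<alpha>) (exploration n M k) \<kappa>
     \<ge> gain \<alpha> / 2 ^ M * (1 + gain \<alpha> / 4) ^ (M - k) * sqrt (real (length \<kappa>))"
  using assms(5,4,6)
proof (induction k arbitrary: \<kappa> rule: inc_induct)
  case base
  let ?V = "reach_prob touches rep (escaped n) (absent \<alpha>)"
  let ?Q = "\<Prod>c\<in>{c \<in> set (block_list n M M). touches \<kappa> c}. absent \<alpha> c"
  \<comment> \<open>At the last scale, finding no loop is counted as failure with value 0, while
    every loop of the block leaves the box and has value 1.\<close>
  have "0 * ?Q + 1 * (1 - ?Q) \<le> ?V (block_list n M M @ exploration n M (Suc M)) \<kappa>"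
  proof (rule reach_prob_block[OF absent_bounds block_list(1)])
    fix c c' assume "c \<in> set (block_list n M M)" "c' \<in> set (block_list n M M)"
    then show "\<not> touches (rep c) c'"
      using blockD(1,2)[OF rep_block_list] base(1) unfolding touches_def by fastforce
  next
    fix c assume "c \<in> set (block_list n M M)"
    then have "escaped n (rep c)"
      using blockD(5)[OF rep_block_list] base(1) unfolding good_def by blast
    then show "1 \<le> ?V (exploration n M (Suc M)) (rep c)" unfolding exploration_def by simp
  qed (simp add: exploration_def)
  then have "1 - ?Q \<le> ?V (exploration n M M) \<kappa>" unfolding exploration_Suc[OF order_refl] by simp
  moreover have "gain \<alpha> * (sqrt (real (length \<kappa>)) / 2 ^ M) \<le> 1 - ?Q"
    using block_hit_prob[OF assms(1) base(1) order_refl assms(2,3) base(2)] by simp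
  ultimately show ?case by simp
next
  case (step k)
  let ?V = "reach_prob touches rep (escaped n) (absent \<alpha>)"
  let ?Q = "\<Prod>c\<in>{c \<in> set (block_list n M k). touches \<kappa> c}. absent \<alpha> c"
  define b where "b = gain \<alpha>"
  define \<phi> where "\<phi> = b / 2 ^ M * (1 + b / 4) ^ (M - Suc k)"
  define s where "s = sqrt (real (length \<kappa>))"
  have b: "b > 0" unfolding b_def using gain_pos[OF assms(1)] .
  have \<phi>: "\<phi> \<ge> 0" unfolding \<phi>_def using b by simp
  have ex: "explorable M (Suc k) \<kappa>"
    using step.prems(2) lattice_box_mono[of "4 ^ k" "4 ^ Suc k" 0] unfolding explorable_def by auto
  have "(\<phi> * s) * ?Q + (\<phi> * 2 ^ k) * (1 - ?Q) \<le> ?V (block_list n M k @ exploration n M (Suc k)) \<kappa>"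
  proof (rule reach_prob_block[OF absent_bounds block_list(1)])
    fix c c' assume "c \<in> set (block_list n M k)" "c' \<in> set (block_list n M k)"
    then show "\<not> touches (rep c) c'"
      using blockD(1,2)[OF rep_block_list] step.prems(1) unfolding touches_def by fastforce
  next
    fix c assume c: "c \<in> set (block_list n M k)"
    note B = blockD[OF rep_block_list[OF c step.prems(1)] step.prems(1)]
    have "explorable M (Suc k) (rep c)"
      using B unfolding explorable_def good_def by auto
    then have "\<phi> * sqrt (real (length (rep c))) \<le> ?V (exploration n M (Suc k)) (rep c)"
      unfolding \<phi>_def b_def by (intro step.IH) auto
    moreover have "2 ^ k \<le> sqrt (real (length (rep c)))"
    proof -
      have "real (4 ^ k) \<le> real (length (rep c))" using B(1) by (simp only: of_nat_le_iff)
      then have "sqrt (4 ^ k) \<le> sqrt (real (length (rep c)))" by simp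
      then show ?thesis by (simp add: real_sqrt_power)
    qed
    ultimately show "\<phi> * 2 ^ k \<le> ?V (exploration n M (Suc k)) (rep c)"
      using mult_left_mono[of "2 ^ k" "sqrt (real (length (rep c)))" \<phi>] \<phi> by linarith
  next
    show "\<phi> * s \<le> ?V (exploration n M (Suc k)) \<kappa>"
      unfolding \<phi>_def b_def s_def using ex by (intro step.IH) auto
  qed
  then have V: "\<phi> * (s + (1 - ?Q) * (2 ^ k - s)) \<le> ?V (exploration n M k) \<kappa>"
    using step.hyps exploration_Suc[of k M n] by (simp add: algebra_simps)
  have hit: "b * (s / 2 ^ k) \<le> 1 - ?Q"
    using block_hit_prob[OF assms(1) step.prems(1) _ assms(2,3) step.prems(2)] step.hyps
    unfolding b_def s_def by simp
  have s: "s \<ge> 0" "2 ^ k / 4 \<le> 2 ^ k - s"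
    using sqrt_explorable_le[OF step.prems(2)] unfolding s_def by auto
  have "b / 4 * s = b * (s / 2 ^ k) * (2 ^ k / 4)" by simp
  also have "\<dots> \<le> (1 - ?Q) * (2 ^ k - s)"
  proof (rule mult_mono[OF hit s(2)])
    have "0 \<le> b * (s / 2 ^ k)" using b s(1) by simp
    then show "0 \<le> 1 - ?Q" using hit by (rule order_trans)
  qed simp
  finally have "\<phi> * (s + b / 4 * s) \<le> ?V (exploration n M k) \<kappa>"
    using mult_left_mono[OF _ \<phi>, of "s + b / 4 * s" "s + (1 - ?Q) * (2 ^ k - s)"] V by linarith
  moreover have "\<phi> * (s + b / 4 * s) = b / 2 ^ M * (1 + b / 4) ^ (M - k) * s"
  proof -
    have "M - k = Suc (M - Suc k)" using step.hyps by simp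
    moreover have "s + b / 4 * s = (1 + b / 4) * s" by (simp add: distrib_right)
    ultimately show ?thesis unfolding \<phi>_def by (simp only: power_Suc mult_ac)
  qed
  ultimately show ?case unfolding b_def s_def by simp
qed

text \<open>The starting state is a single vertex and not a loop; its energy is one diagonal value
  of \<open>green\<close>, at most 24.\<close>

lemma explorable_origin: "explorable M 1 [0]"
  unfolding explorable_def low_energy_def energy_def pow32_def
  using green_le[of "2 * 4 ^ M" 0 0] by (simp add: mem_lattice_box)

section \<open>From a successful exploration to an open path\<close>

lemma open_loop_connected:
  assumes sets: "sets \<eta> = Pow loops" and l: "l \<in> block n M k" "k \<ge> 1"
    and pres: "emeasure \<eta> {loop_class l} \<ge> 1"
    and uv: "u \<in> set (rep (loop_class l))" "v \<in> set (rep (loop_class l))"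
  shows "(open_edge \<eta>)\<^sup>*\<^sup>* u v"
proof -
  let ?r = "rep (loop_class l)"
  have bl: "l \<in> based_loops" using block_based l by blast
  have r: "?r \<in> loop_class l" using rep_in[OF bl] .
  have cw: "?r \<in> closed_walks (length ?r)" using blockD(4)[OF rep_block(1)[OF l] l(2)] .
  obtain a where a: "a < length ?r" "u = ?r ! a" using uv(1) by (metis in_set_conv_nth)
  have edge: "open_edge \<eta> (?r ! i) (?r ! (Suc i mod length ?r))" if "i < length ?r" for i
  proof -
    let ?S = "{L \<in> loops. traverses L (?r ! i) (?r ! (Suc i mod length ?r))}"
    have "loop_class l \<in> loops" unfolding loops_def using bl by (rule quotientI)
    moreover have "traverses (loop_class l) (?r ! i) (?r ! (Suc i mod length ?r))"
      unfolding traverses_def using r that by blast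
    ultimately have "emeasure \<eta> {loop_class l} \<le> emeasure \<eta> ?S"
      using sets by (intro emeasure_mono) auto
    then have "1 \<le> emeasure \<eta> ?S" using pres order_trans by blast
    moreover have "adj (?r ! i) (?r ! (Suc i mod length ?r))" using cw that unfolding closed_walks_def by blast
    ultimately show ?thesis unfolding open_edge_def by blast
  qed
  have walk: "(open_edge \<eta>)\<^sup>*\<^sup>* (rotate a ?r ! 0) (rotate a ?r ! m)" if "m < length ?r" for m
    using that
  proof (induction m)
    case (Suc m)
    have "rotate a ?r ! m = ?r ! ((a + m) mod length ?r)" "rotate a ?r ! Suc m = ?r ! (Suc ((a + m) mod length ?r) mod length ?r)"
      using Suc.prems by (simp_all add: nth_rotate mod_simps)
    moreover have "(a + m) mod length ?r < length ?r" using a(1) by (intro mod_less_divisor) linarith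
    ultimately have "open_edge \<eta> (rotate a ?r ! m) (rotate a ?r ! Suc m)" using edge by metis
    then show ?case using Suc by (meson Suc_lessD rtranclp.rtrancl_into_rtrancl)
  qed simp
  have "0 < length ?r" using a(1) by linarith
  then have "u = rotate a ?r ! 0" using a nth_rotate[of 0 ?r a] by simp
  moreover obtain m where "m < length ?r" "v = rotate a ?r ! m"
    using uv(2) by (metis in_set_conv_nth length_rotate set_rotate)
  ultimately show ?thesis using walk by metis
qed

text \<open>The invariant, that all vertices of the state are joined to 0, passes to the next loop
  through a shared vertex.\<close>

lemma reaches_connected:
  assumes "sets \<eta> = Pow loops" "reaches touches rep (escaped n) (\<lambda>c. emeasure \<eta> {c} \<ge> 1) cs \<kappa>"
    and "\<And>c. c \<in> set cs \<Longrightarrow> \<exists>k\<ge>1. c \<in> loop_class ` block n M k"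
    and "\<And>v. v \<in> set \<kappa> \<Longrightarrow> (open_edge \<eta>)\<^sup>*\<^sup>* 0 v"
  shows "\<exists>v. v \<notin> lattice_box 0 n \<and> (open_edge \<eta>)\<^sup>*\<^sup>* 0 v"
  using assms(2-)
proof (induction cs arbitrary: \<kappa>)
  case Nil
  then show ?case by auto
next
  case (Cons c cs)
  show ?case
  proof (cases "touches \<kappa> c \<and> emeasure \<eta> {c} \<ge> 1")
    case False
    then have "reaches touches rep (escaped n) (\<lambda>c. emeasure \<eta> {c} \<ge> 1) cs \<kappa>"
      using Cons.prems(1) by auto
    then show ?thesis using Cons.IH Cons.prems by simp
  next
    case True
    obtain k l where l: "k \<ge> 1" "l \<in> block n M k" "c = loop_class l" using Cons.prems(2)[of c] by auto
    obtain u where u: "u \<in> set \<kappa>" "u \<in> set (rep c)" using True unfolding touches_def by blast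
    have "(open_edge \<eta>)\<^sup>*\<^sup>* 0 v" if v: "v \<in> set (rep c)" for v
    proof -
      have "(open_edge \<eta>)\<^sup>*\<^sup>* u v"
        using open_loop_connected[OF assms(1) l(2,1)] True u(2) v unfolding l(3) by blast
      then show ?thesis using Cons.prems(3)[OF u(1)] by simp
    qed
    moreover have "reaches touches rep (escaped n) (\<lambda>c. emeasure \<eta> {c} \<ge> 1) cs (rep c)"
      using Cons.prems(1) True by simp
    ultimately show ?thesis using Cons.IH Cons.prems(2) by simp
  qed
qed

text \<open>The vertex before the first step out of \<open>F\<close> lies in
  \<open>inner_boundary F\<close> and is joined to \<open>x\<close>.\<close>

lemma leaving_meets_inner_boundary:
  assumes "(open_edge \<eta>)\<^sup>*\<^sup>* x v" "x \<in> F" "v \<notin> F"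
  shows "connected_to \<eta> x (inner_boundary F)"
proof -
  have "v \<in> F \<or> connected_to \<eta> x (inner_boundary F)"
    using assms(1)
  proof (induction rule: rtranclp_induct)
    case base
    then show ?case using assms(2) by simp
  next
    case (step y z)
    then show ?case unfolding connected_to_def inner_boundary_def open_edge_def by blast
  qed
  then show ?thesis using assms(3) by simp
qed

text \<open>Needed because monotonicity of the measure asks for a measurable larger event.
  Connection is built from edge events by countable unions over vertices and path lengths.\<close>

lemma measurable_connected_to:
  assumes ppp: "poisson_point_process (scale_measure r loop_measure) P"
  shows "Measurable.pred P (\<lambda>\<eta>. connected_to \<eta> (x :: int ^ 3) A)"
proof -
  have [measurable]: "Measurable.pred P (\<lambda>\<eta>. open_edge \<eta> y z)" for y z :: "int ^ 3"
  proof -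
    have "{L \<in> loops. traverses L y z} \<in> sets (scale_measure r loop_measure)"
      by (auto simp: sets_loop_measure)
    then have [measurable]: "(\<lambda>\<eta>. emeasure \<eta> {L \<in> loops. traverses L y z}) \<in> borel_measurable P"
      by (rule ppp_measurable[OF ppp])
    show ?thesis unfolding open_edge_def by measurable
  qed
  have [measurable]: "Measurable.pred P (\<lambda>\<eta>. (open_edge \<eta> ^^ m) x y)" for m and y :: "int ^ 3"
  proof (induction m arbitrary: y)
    case (Suc m)
    note Suc[measurable]
    have "(\<lambda>\<eta>. (open_edge \<eta> ^^ Suc m) x y) = (\<lambda>\<eta>. \<exists>z. (open_edge \<eta> ^^ m) x z \<and> open_edge \<eta> z y)"
      by (auto simp: OO_def)
    then show ?case by simp
  qed simp
  have "(\<lambda>\<eta>. connected_to \<eta> x A) = (\<lambda>\<eta>. \<exists>y. y \<in> A \<and> (\<exists>m. (open_edge \<eta> ^^ m) x y))"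
    unfolding connected_to_def rtranclp_power by blast
  then show ?thesis by simp
qed

lemma connection_prob_lower:
  assumes "\<alpha> > 0" "n > 0" "2 ^ M \<ge> 216 * real n" "1 \<le> M"
    and ppp: "poisson_point_process (scale_measure (ennreal \<alpha>) (loop_measure :: (int ^ 3) list set measure)) P"
  shows "measure P {\<eta> \<in> space P. connected_to \<eta> 0 (inner_boundary (lattice_box 0 n))}
     \<ge> gain \<alpha> / 2 ^ M * (1 + gain \<alpha> / 4) ^ (M - 1)"
proof -
  interpret prob_space P by (rule ppp_prob_space[OF ppp])
  let ?cs = "exploration n M 1"
  let ?R = "\<lambda>\<eta>. reaches touches rep (escaped n) (\<lambda>c. emeasure \<eta> {c} \<ge> 1) ?cs [0]"
  have cs: "\<exists>k\<ge>1. c \<in> loop_class ` block n M k" if "c \<in> set ?cs" for c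
    using that unfolding set_exploration block_list(2) by auto
  have s1: "{c} \<in> sets (scale_measure (ennreal \<alpha>) loop_measure)" if c: "c \<in> set ?cs" for c
  proof -
    obtain k l where l: "k \<ge> 1" "l \<in> block n M k" "c = loop_class l" using cs[OF c] by auto
    have "c \<in> loops" unfolding loops_def l(3) by (rule quotientI[OF block_based[OF l(2,1)]])
    then show ?thesis by (simp add: sets_loop_measure)
  qed
  have s2: "emeasure (scale_measure (ennreal \<alpha>) loop_measure) {c} < \<infinity>" if c: "c \<in> set ?cs" for c
  proof -
    obtain k l where l: "k \<ge> 1" "l \<in> block n M k" "c = loop_class l" using cs[OF c] by auto
    show ?thesis using emeasure_loop_singleton[OF l(2,1)] unfolding l(3) by (simp add: ennreal_mult_less_top)
  qed
  have "gain \<alpha> / 2 ^ M * (1 + gain \<alpha> / 4) ^ (M - 1) * sqrt (real (length [0 :: int ^ 3]))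
      \<le> reach_prob touches rep (escaped n) (absent \<alpha>) ?cs [0]"
    by (rule reach_prob_lower[OF assms(1-3) order_refl assms(4) explorable_origin])
  also have "\<dots> = prob {\<eta> \<in> space P. ?R \<eta>}"
    unfolding absent_def by (rule prob_reaches[OF ppp distinct_exploration[OF order_refl] s1 s2, symmetric])
  also have "\<dots> \<le> prob {\<eta> \<in> space P. connected_to \<eta> 0 (inner_boundary (lattice_box 0 n))}"
  proof (rule finite_measure_mono)
    show "{\<eta> \<in> space P. connected_to \<eta> 0 (inner_boundary (lattice_box 0 n))} \<in> events"
      using measurable_connected_to[OF ppp] by (simp add: pred_def)
    show "{\<eta> \<in> space P. ?R \<eta>} \<subseteq> {\<eta> \<in> space P. connected_to \<eta> 0 (inner_boundary (lattice_box 0 n))}"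
    proof
      fix \<eta> assume \<eta>: "\<eta> \<in> {\<eta> \<in> space P. ?R \<eta>}"
      then have "sets \<eta> = Pow loops" using ppp_sets[OF ppp] by (simp add: sets_loop_measure)
      then obtain v where v: "v \<notin> lattice_box 0 n" "(open_edge \<eta>)\<^sup>*\<^sup>* 0 v"
        using reaches_connected[of \<eta> n ?cs "[0]" M] \<eta> cs by auto
      have "(0 :: int ^ 3) \<in> lattice_box 0 n" by (simp add: mem_lattice_box)
      then show "\<eta> \<in> {\<eta> \<in> space P. connected_to \<eta> 0 (inner_boundary (lattice_box 0 n))}"
        using leaving_meets_inner_boundary[OF v(2)] v(1) \<eta> by simp
    qed
  qed
  finally show ?thesis by simp
qed

theorem theorem1p5:
  "\<forall>\<alpha>::real. \<alpha> > 0 \<longrightarrow> (\<exists>\<epsilon> c :: real. \<epsilon> > 0 \<and> c > 0 \<and>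
     (\<forall>P. poisson_point_process
            (scale_measure (ennreal \<alpha>) (loop_measure :: (int ^ 3) list set measure)) P \<longrightarrow>
        (\<forall>n::nat. n \<ge> 1 \<longrightarrow>
           measure P {\<eta> \<in> space P. connected_to \<eta> 0 (inner_boundary (lattice_box 0 n))}
             \<ge> c * real n powr (- 1 + \<epsilon>))))"
proof (intro allI impI)
  fix \<alpha> :: real assume \<alpha>: "\<alpha> > 0"
  define b where "b = gain \<alpha>"
  \<comment> \<open>With this choice \<open>(2 ^ M) powr \<epsilon> = (1 + b / 4) ^ M\<close>, so
    the accumulated factor becomes a power of \<open>n\<close>.\<close>
  define \<epsilon> where "\<epsilon> = log 2 (1 + b / 4)"
  \<comment> \<open>512 bounds \<open>2 ^ M / n\<close>, and \<open>1 + b / 4\<close> accounts for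
    the exponent \<open>M - 1\<close>.\<close>
  define c where "c = b / (512 * (1 + b / 4))"
  have b: "b > 0" unfolding b_def using gain_pos[OF \<alpha>] .
  have \<epsilon>: "\<epsilon> > 0" unfolding \<epsilon>_def using b by simp
  have c: "c > 0" unfolding c_def using b by simp
  have "measure P {\<eta> \<in> space P. connected_to \<eta> 0 (inner_boundary (lattice_box 0 n))}
             \<ge> c * real n powr (- 1 + \<epsilon>)"
    if P: "poisson_point_process (scale_measure (ennreal \<alpha>) (loop_measure :: (int ^ 3) list set measure)) P"
      and n: "n \<ge> 1" for P and n :: nat
  proof -
    \<comment> \<open>256 exceeds the 216 that escape at the last scale requires; the outcome is
      \<open>256 * n < 2 ^ M \<le> 512 * n\<close>.\<close>
    obtain m where m: "2 ^ m \<le> 256 * n" "256 * n < 2 ^ (m + 1)"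
      using ex_power_ivl1[of 2 "256 * n"] n by auto
    define M where "M = m + 1"
    have "real (256 * n) \<le> real (2 ^ M)" using m(2) unfolding M_def of_nat_le_iff by simp
    then have lo: "256 * real n \<le> 2 ^ M" by simp
    have "real (2 ^ M) \<le> real (512 * n)" using m(1) unfolding M_def of_nat_le_iff by simp
    then have hi: "2 ^ M \<le> 512 * real n" by simp
    have pw: "real n powr \<epsilon> \<le> (1 + b / 4) ^ M"
    proof -
      have "real n powr \<epsilon> \<le> (2 ^ M) powr \<epsilon>" 
      proof (rule powr_mono2)
        show "real n \<le> 2 ^ M" using lo by linarith
      qed (use \<epsilon> in auto)
      also have "(2 ^ M) powr \<epsilon> = (2 powr real M) powr \<epsilon>" by (simp add: powr_realpow)
      also have "\<dots> = (2 powr \<epsilon>) powr real M" by (simp only: powr_powr mult.commute)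
      also have "\<dots> = (2 powr \<epsilon>) ^ M" by (simp add: powr_realpow)
      also have "2 powr \<epsilon> = 1 + b / 4" unfolding \<epsilon>_def using b by simp
      finally show ?thesis .
    qed
    have "real n powr (- 1 + \<epsilon>) = real n powr \<epsilon> / real n"
      using n powr_diff[of "real n" \<epsilon> 1] by (simp add: add.commute[of "- 1"])
    then have "c * real n powr (- 1 + \<epsilon>) = b / (512 * real n) * (real n powr \<epsilon> / (1 + b / 4))"
      unfolding c_def by simp
    also have "\<dots> \<le> b / 2 ^ M * ((1 + b / 4) ^ M / (1 + b / 4))"
      using b hi pw n by (intro mult_mono divide_left_mono divide_right_mono) auto
    also have "(1 + b / 4) ^ M / (1 + b / 4) = (1 + b / 4) ^ (M - 1)"
      unfolding M_def using b by simp
    also have "b / 2 ^ M * (1 + b / 4) ^ (M - 1)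
        \<le> measure P {\<eta> \<in> space P. connected_to \<eta> 0 (inner_boundary (lattice_box 0 n))}"
      unfolding b_def using n lo by (intro connection_prob_lower[OF \<alpha> _ _ _ P]) (auto simp: M_def)
    finally show ?thesis .
  qed
  then show "\<exists>\<epsilon> c :: real. \<epsilon> > 0 \<and> c > 0 \<and>
     (\<forall>P. poisson_point_process
            (scale_measure (ennreal \<alpha>) (loop_measure :: (int ^ 3) list set measure)) P \<longrightarrow>
        (\<forall>n::nat. n \<ge> 1 \<longrightarrow>
           measure P {\<eta> \<in> space P. connected_to \<eta> 0 (inner_boundary (lattice_box 0 n))}
             \<ge> c * real n powr (- 1 + \<epsilon>)))"
    using \<epsilon> c by blast
qed

end
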